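(* Let $l$ be a prime number, $k\subset\mathbb{C}$ a number field containing $\zeta_l=\exp(2\pi\sqrt{-1}/l)$, $c\in k^\times$, and $$\mathcal{R}^{(l)}=k(t)\big(t^{1/l},(c^l-t)^{1/l},\varepsilon_l(t)^{1/l}\big),\qquad \varepsilon_l(t)=\prod_{i=1}^{l-1}(c-\zeta_l^it^{1/l})^i .$$ Then $\mathcal{R}^{(l)}$ is a Galois extension of $k(t)$ whose Galois group $\mathrm{Gal}(\mathcal{R}^{(l)}/k(t))$ is isomorphic to the mod $l$ Heisenberg group $$H(\mathbb{F}_l)=\left\{\begin{pmatrix}1&*&*\\0&1&*\\0&0&1\end{pmatrix}\;\Big|\;*\in\mathbb{F}_l\right\},$$ and $\mathcal{R}^{(l)}/k(t)$ is unramified outside $\infty$, $0$ and $c^l$.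
   Context: $k(t)$ is the function field of the projective $t$-line $\mathbb{P}^1$ over $k$, and "unramified outside $\infty,0,c^l$" refers to the points of $\mathbb{P}^1$. The $l$-th roots are taken in a fixed algebraic closure of $k(t)$. *)

theory Defs
  imports
    "HOL-Algebra.Algebraic_Closure_Type"
    "HOL-Algebra.Generated_Fields"
    "HOL-Algebra.Bij"
    "HOL-Number_Theory.Residues"
    "HOL-Analysis.Cartesian_Space"
begin

unbundle no Formal_Power_Series.fps_syntax

section \<open>Number fields and rational function fields\<close>

definition number_field :: "complex set \<Rightarrow> bool" where
  "number_field k \<longleftrightarrow>
     subfield k ring_of_type_algebra \<and>
     ring.finite_dimension (ring_of_type_algebra :: complex ring) \<rat> k"

text \<open>The ring $K[X]$ for a subset \<open>K\<close> of a ring, as a subring of the type of all polynomials.\<close>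

definition polys_over :: "'a::comm_ring_1 set \<Rightarrow> 'a poly ring" where
  "polys_over K = ring_of_type_algebra \<lparr>carrier := {p. \<forall>i. Polynomial.coeff p i \<in> K}\<rparr>"

abbreviation irreducible_over :: "'a::comm_ring_1 set \<Rightarrow> 'a poly \<Rightarrow> bool" where
  "irreducible_over K p \<equiv> p \<in> carrier (polys_over K) \<and> ring_irreducible\<^bsub>polys_over K\<^esub> p"

text \<open>The field $k(t)$ for a subfield \<open>k\<close> of the complex numbers, as a subfield of $\mathbb{C}(t)$.\<close>

definition rat_funs :: "complex set \<Rightarrow> complex poly fract set" where
  "rat_funs k = {to_fract a / to_fract b | a b.
     a \<in> carrier (polys_over k) \<and> b \<in> carrier (polys_over k) \<and> b \<noteq> 0}"

definition rat_fun_field :: "complex set \<Rightarrow> complex poly fract ring" where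
  "rat_fun_field k = ring_of_type_algebra \<lparr>carrier := rat_funs k\<rparr>"

definition const_fun :: "complex \<Rightarrow> complex poly fract" where
  "const_fun a = to_fract [:a:]"

definition indet :: "complex poly fract" where
  "indet = to_fract [:0, 1:]"

text \<open>
  An algebraic closure of $k(t)$: a field of type \<open>'a\<close> with an embedding \<open>\<iota>\<close> of $k(t)$ over whose
  image it is an algebraic closure. The values of \<open>\<iota>\<close> outside $k(t)$ are irrelevant.
\<close>

definition algebraic_closure_via :: "complex set \<Rightarrow> (complex poly fract \<Rightarrow> 'a::field) \<Rightarrow> bool" where
  "algebraic_closure_via k \<iota> \<longleftrightarrow>
     \<iota> \<in> ring_hom (rat_fun_field k) ring_of_type_algebra \<and>
     algebraic_closure ring_of_type_algebra (\<iota> ` rat_funs k)"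


section \<open>Galois extensions\<close>

definition normal_extension :: "'a::field set \<Rightarrow> 'a set \<Rightarrow> bool" where
  "normal_extension K L \<longleftrightarrow>
     (\<forall>p. irreducible_over K p \<and> (\<exists>x\<in>L. poly p x = 0) \<longrightarrow>
        (\<exists>a xs. set xs \<subseteq> L \<and> p = Polynomial.smult a (\<Prod>x\<leftarrow>xs. [:- x, 1:])))"

definition separable_extension :: "'a::field set \<Rightarrow> 'a set \<Rightarrow> bool" where
  "separable_extension K L \<longleftrightarrow>
     (\<forall>p. irreducible_over K p \<and> (\<exists>x\<in>L. poly p x = 0) \<longrightarrow> Rings.coprime p (pderiv p))"

definition galois_extension :: "'a::field set \<Rightarrow> 'a set \<Rightarrow> bool" where
  "galois_extension K L \<longleftrightarrow>
     subfield K ring_of_type_algebra \<and> subfield L ring_of_type_algebra \<and> K \<subseteq> L \<and>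
     (\<forall>x\<in>L. (ring.algebraic ring_of_type_algebra over K) x) \<and>
     normal_extension K L \<and> separable_extension K L"

text \<open>As in \<open>AutoGroup\<close>, automorphisms of \<open>L\<close> are taken extensional, so that each is counted once.\<close>

definition galois_group :: "'a::field set \<Rightarrow> 'a set \<Rightarrow> ('a \<Rightarrow> 'a) monoid" where
  "galois_group K L =
     (let F = ring_of_type_algebra \<lparr>carrier := L\<rparr> in
      BijGroup L \<lparr>carrier := {\<sigma> \<in> ring_iso F F \<inter> extensional L. \<forall>x\<in>K. \<sigma> x = x}\<rparr>)"


section \<open>The Heisenberg group over a ring\<close>

definition heisenberg_group :: "'a::zero ring \<Rightarrow> ('a ^ 3 ^ 3) monoid" where
  "heisenberg_group R =
     \<lparr>carrier = {vector [vector [\<one>\<^bsub>R\<^esub>, a, b],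
                          vector [\<zero>\<^bsub>R\<^esub>, \<one>\<^bsub>R\<^esub>, c],
                          vector [\<zero>\<^bsub>R\<^esub>, \<zero>\<^bsub>R\<^esub>, \<one>\<^bsub>R\<^esub>]] | a b c.
                  a \<in> carrier R \<and> b \<in> carrier R \<and> c \<in> carrier R},
      monoid.mult = \<lambda>A B. \<chi> i j. \<Oplus>\<^bsub>R\<^esub>m\<in>UNIV. A $ i $ m \<otimes>\<^bsub>R\<^esub> B $ m $ j,
      one = \<chi> i j. if i = j then \<one>\<^bsub>R\<^esub> else \<zero>\<^bsub>R\<^esub>\<rparr>"


section \<open>Ramification over the projective line\<close>

text \<open>
  Closed points of the projective line over \<open>k\<close>: the point at infinity, and one point for each
  monic irreducible polynomial over \<open>k\<close>. The rational point $t = a$ corresponds to $t - a$.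
\<close>

datatype closed_point = At_infinity | Affine "complex poly"

definition closed_points :: "complex set \<Rightarrow> closed_point set" where
  "closed_points k =
     insert At_infinity
       (Affine ` {p. irreducible_over k p \<and> Polynomial.lead_coeff p = 1})"

definition rational_point :: "complex \<Rightarrow> closed_point" where
  "rational_point a = Affine [:- a, 1:]"

text \<open>
  The order of vanishing of a nonzero polynomial in $k[t]$ at a closed point. The multiplicity is
  that in $\mathbb{C}[t]$; it agrees with the one in $k[t]$, since for \<open>p\<close>, \<open>a\<close> over \<open>k\<close> the
  quotient of \<open>a\<close> by a power of \<open>p\<close> dividing it is again over \<open>k\<close>.
\<close>

fun ord_at :: "closed_point \<Rightarrow> complex poly \<Rightarrow> int" where
  "ord_at At_infinity a = - int (Polynomial.degree a)"
| "ord_at (Affine p) a = int (multiplicity p a)"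

text \<open>Normalised discrete valuations of a field \<open>L\<close>; the value at \<open>0\<close> (infinity) is not represented.\<close>

definition discrete_valuation_on :: "'a::field set \<Rightarrow> ('a \<Rightarrow> int) \<Rightarrow> bool" where
  "discrete_valuation_on L w \<longleftrightarrow>
     (\<forall>x\<in>L - {0}. \<forall>y\<in>L - {0}. w (x * y) = w x + w y) \<and>
     (\<forall>x\<in>L - {0}. \<forall>y\<in>L - {0}. x + y \<noteq> 0 \<longrightarrow> w (x + y) \<ge> min (w x) (w y)) \<and>
     w ` (L - {0}) = UNIV"

text \<open>
  The restriction of \<open>w\<close> to $k(t)$ is \<open>e\<close> times the normalised valuation of the point \<open>P\<close>,
  that is, \<open>w\<close> lies above \<open>P\<close> with ramification index \<open>e\<close>.
\<close>

definition lies_above ::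
  "complex set \<Rightarrow> (complex poly fract \<Rightarrow> 'a::field) \<Rightarrow> ('a \<Rightarrow> int) \<Rightarrow> closed_point \<Rightarrow> nat \<Rightarrow> bool" where
  "lies_above k \<iota> w P e \<longleftrightarrow> e > 0 \<and>
     (\<forall>a\<in>carrier (polys_over k) - {0}. \<forall>b\<in>carrier (polys_over k) - {0}.
        w (\<iota> (to_fract a / to_fract b)) = int e * (ord_at P a - ord_at P b))"

text \<open>
  Residue fields have characteristic \<open>0\<close>, so their extensions are separable and being unramified
  only concerns the ramification indices.
\<close>

definition unramified_at ::
  "complex set \<Rightarrow> (complex poly fract \<Rightarrow> 'a::field) \<Rightarrow> 'a set \<Rightarrow> closed_point \<Rightarrow> bool" where
  "unramified_at k \<iota> L P \<longleftrightarrow>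
     (\<forall>w e. discrete_valuation_on L w \<and> lies_above k \<iota> w P e \<longrightarrow> e = 1)"

definition unramified_outside ::
  "complex set \<Rightarrow> (complex poly fract \<Rightarrow> 'a::field) \<Rightarrow> 'a set \<Rightarrow> closed_point set \<Rightarrow> bool" where
  "unramified_outside k \<iota> L S \<longleftrightarrow> (\<forall>P \<in> closed_points k - S. unramified_at k \<iota> L P)"

end

theory Submission
  imports Defs
begin

text \<open>
  The extension is a tower of three Kummer extensions of degree \<open>l\<close>, adjoining \<open>x\<close>, \<open>y\<close>, \<open>z\<close> in turn.
  That each step is proper comes down to the order of vanishing of $t$ at \<open>0\<close> and of $c^l - t$ at
  $c^l$: if \<open>z\<close> were in $K(x, y)$, then $z = b y^j$ with \<open>b\<close> in $K(x)$, and comparing with the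
  conjugate under $x \mapsto \zeta x$, using
  $\varepsilon(\zeta x) (c^l - t) = \varepsilon(x) (c - x)^l$, would put \<open>y\<close> in $K(x)$.
  The same identity says how automorphisms act on \<open>z\<close> and makes composition the multiplication of
  unitriangular matrices. There are enough automorphisms for their fixed field to be \<open>K\<close>, so orbit
  polynomials show that the extension is Galois. Away from the three points, \<open>x\<close>, \<open>y\<close> and \<open>z\<close> are
  units, and adjoining an \<open>l\<close>-th root of a unit does not change the value group of a valuation.
\<close>


section \<open>Polynomials over subrings and residue fields\<close>

text \<open>No completion, residue field or quotient ring is ever formed. Irreducibility over a
  subfield and irreducibility over a residue field are both read as statements modulo a prime ideal
  \<open>m\<close> of a ring \<open>V\<close> and proved once, in \<open>local_pair\<close>. The
  valuation part is delicate because \<theta> may lie outside M and yet be a limit of elements of M.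
  Then \<open>X^l - \<theta>^l\<close> splits over the residue field although it is irreducible over
  M. A single value \<open>w u\<close> only calls for finite precision, so approximations inside M
  take the place of a completion. Value groups are compared instead of ramification indices: "every
  value on E is a value on M" passes through three steps without renormalising restrictions of
  \<open>w\<close>. The exponent i of \<open>C - \<zeta>^i x\<close> in \<epsilon> is made so that
  \<open>x \<mapsto> \<zeta> x\<close> lowers all exponents by one. Up to an l-th power, \<epsilon>
  is then divided by the product of all factors, which is \<open>y^l\<close>. Hence conjugates of
  \<open>z\<close> stay in the field, but their ratio to \<open>z\<close> involves \<open>y\<close>,
  and this is where commutativity fails.\<close>

abbreviation polys :: "'a::comm_ring_1 set \<Rightarrow> 'a poly set" where
  "polys A \<equiv> carrier (polys_over A)"

lemma polys_iff: "p \<in> polys A \<longleftrightarrow> (\<forall>i. Polynomial.coeff p i \<in> A)"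
  by (simp add: polys_over_def)

locale unital_subring =
  fixes A :: "'a::comm_ring_1 set"
  assumes zero_closed: "0 \<in> A" and one_closed: "1 \<in> A"
    and add_closed: "a \<in> A \<Longrightarrow> b \<in> A \<Longrightarrow> a + b \<in> A"
    and mult_closed: "a \<in> A \<Longrightarrow> b \<in> A \<Longrightarrow> a * b \<in> A"
    and uminus_closed: "a \<in> A \<Longrightarrow> - a \<in> A"
begin

lemma diff_closed: "a \<in> A \<Longrightarrow> b \<in> A \<Longrightarrow> a - b \<in> A"
  using add_closed[of a "- b"] uminus_closed[of b] by simp

lemma power_closed: "a \<in> A \<Longrightarrow> a ^ n \<in> A"
  by (induction n) (auto intro: one_closed mult_closed)

lemma sum_closed: "(\<And>i. i \<in> I \<Longrightarrow> f i \<in> A) \<Longrightarrow> sum f I \<in> A"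
  by (induction I rule: infinite_finite_induct) (auto intro: zero_closed add_closed)

lemma prod_closed: "(\<And>i. i \<in> I \<Longrightarrow> f i \<in> A) \<Longrightarrow> prod f I \<in> A"
  by (induction I rule: infinite_finite_induct) (auto intro: one_closed mult_closed)

lemma of_nat_closed: "of_nat n \<in> A"
  by (induction n) (auto intro: zero_closed one_closed add_closed)

lemmas closed = zero_closed one_closed add_closed mult_closed uminus_closed diff_closed
  power_closed sum_closed prod_closed of_nat_closed

lemma unital_subring_polys: "unital_subring (polys A)"
  by unfold_locales
    (auto simp: polys_iff coeff_mult Polynomial.coeff_1 intro!: closed)

lemmas polys_closed = unital_subring.closed [OF unital_subring_polys]

lemma const_polys: "a \<in> A \<Longrightarrow> [:a:] \<in> polys A"
  by (auto simp: polys_iff coeff_pCons zero_closed split: nat.split)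

lemma pCons_polys: "a \<in> A \<Longrightarrow> p \<in> polys A \<Longrightarrow> pCons a p \<in> polys A"
  by (auto simp: polys_iff coeff_pCons split: nat.split)

lemma monom_polys: "a \<in> A \<Longrightarrow> Polynomial.monom a n \<in> polys A"
  by (auto simp: polys_iff zero_closed)

lemma smult_polys: "a \<in> A \<Longrightarrow> p \<in> polys A \<Longrightarrow> Polynomial.smult a p \<in> polys A"
  by (auto simp: polys_iff mult_closed)

lemma linear_polys: "a \<in> A \<Longrightarrow> [:- a, 1:] \<in> polys A"
  by (intro pCons_polys const_polys closed)

lemma poly_closed: "p \<in> polys A \<Longrightarrow> a \<in> A \<Longrightarrow> poly p a \<in> A"
  by (auto simp: poly_altdef polys_iff intro!: closed)

lemma synthetic_div_polys:
  "p \<in> polys A \<Longrightarrow> a \<in> A \<Longrightarrow> synthetic_div p a \<in> polys A"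
proof (induction p)
  case 0
  then show ?case by (simp add: polys_iff)
next
  case (pCons b p)
  have p: "p \<in> polys A"
    using pCons.prems(1) unfolding polys_iff by (metis coeff_pCons_Suc)
  show ?case
    using pCons p by (auto simp: synthetic_div_pCons intro!: pCons_polys poly_closed)
qed

text \<open>With a monic divisor no inverses are needed, so division works over any subring. The
  remainder is bounded through its coefficients rather than its degree, so that \<open>r = 0\<close>
  and a constant \<open>g\<close> need no separate treatment.\<close>

lemma monic_division:
  assumes g: "g \<in> polys A" "Polynomial.lead_coeff g = 1" and f: "f \<in> polys A"
  shows "\<exists>q\<in>polys A. \<exists>r\<in>polys A. f = g * q + r \<and> (\<forall>i\<ge>Polynomial.degree g. Polynomial.coeff r i = 0)"
  using f
proof (induction f)
  case 0
  have "0 \<in> polys A" by (simp add: polys_iff zero_closed)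
  then show ?case by (intro bexI[of _ 0]) auto
next
  case (pCons a f)
  have f: "f \<in> polys A" and a: "a \<in> A"
    using pCons.prems unfolding polys_iff by (metis coeff_pCons_Suc, metis coeff_pCons_0)
  from pCons.IH[OF f] obtain q r where qr: "q \<in> polys A" "r \<in> polys A" "f = g * q + r"
    and r0: "\<And>i. i \<ge> Polynomial.degree g \<Longrightarrow> Polynomial.coeff r i = 0" by blast
  \<comment> \<open>Multiplying by X may push the remainder up to the degree of \<open>g\<close>,
    but no further; \<open>d\<close> is the coefficient reached there, cancelled by subtracting
    \<open>d\<close> times \<open>g\<close>.\<close>
  define d where "d = Polynomial.coeff (pCons a r) (Polynomial.degree g)"
  have pr: "pCons a r \<in> polys A" using a qr(2) by (rule pCons_polys)
  hence d: "d \<in> A" by (simp add: polys_iff d_def)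
  have "pCons a f = pCons 0 (g * q) + pCons a r" by (simp add: qr(3))
  also have "\<dots> = g * (pCons 0 q + [:d:]) + (pCons a r - Polynomial.smult d g)"
    by (simp add: algebra_simps)
  finally have "pCons a f = g * (pCons 0 q + [:d:]) + (pCons a r - Polynomial.smult d g)" .
  moreover have "pCons 0 q + [:d:] \<in> polys A"
    by (intro polys_closed pCons_polys const_polys d qr closed)
  moreover have "pCons a r - Polynomial.smult d g \<in> polys A"
    by (intro polys_closed pr smult_polys d g)
  moreover have "Polynomial.coeff (pCons a r - Polynomial.smult d g) i = 0" if "i \<ge> Polynomial.degree g" for i
  proof (cases "i = Polynomial.degree g")
    case True
    then show ?thesis using g by (simp add: d_def)
  next
    case False
    with that have i: "i > Polynomial.degree g" by simp
    then obtain j where "i = Suc j" "j \<ge> Polynomial.degree g" by (cases i) auto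
    with i r0 show ?thesis by (simp add: coeff_eq_0)
  qed
  ultimately show ?case by blast
qed

end

text \<open>A prime ideal \<open>m\<close> of a ring \<open>V\<close>, and a subring \<open>A\<close> of \<open>V\<close> that is local at \<open>m\<close>. With
  \<open>m = {0}\<close> and \<open>A\<close> a field this covers linear algebra over \<open>A\<close>; with a valuation ring \<open>V\<close> it is
  linear algebra over the residue field.\<close>

locale local_pair = V: unital_subring V + A: unital_subring A
  for V A :: "'a::field set" +
  fixes m :: "'a set"
  assumes subset: "A \<subseteq> V" "m \<subseteq> V"
    and m_zero: "0 \<in> m"
    and m_one: "1 \<notin> m"
    and m_add: "a \<in> m \<Longrightarrow> b \<in> m \<Longrightarrow> a + b \<in> m"
    and m_mult: "a \<in> V \<Longrightarrow> b \<in> m \<Longrightarrow> a * b \<in> m"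
    and m_prime: "a \<in> V \<Longrightarrow> b \<in> V \<Longrightarrow> a * b \<in> m \<Longrightarrow> a \<in> m \<or> b \<in> m"
    and unit: "a \<in> A \<Longrightarrow> a \<notin> m \<Longrightarrow> inverse a \<in> A"
begin

lemma m_uminus: "a \<in> m \<Longrightarrow> - a \<in> m"
  using m_mult[of "-1" a] V.uminus_closed[OF V.one_closed] by simp

lemma m_diff: "a \<in> m \<Longrightarrow> b \<in> m \<Longrightarrow> a - b \<in> m"
  using m_add[of a "- b"] m_uminus[of b] by simp

lemma m_diff_iff: "a - b \<in> m \<Longrightarrow> a \<in> m \<longleftrightarrow> b \<in> m"
  using m_diff[of a "a - b"] m_add[of "a - b" b] by auto

lemma m_power: "a \<in> V \<Longrightarrow> a ^ n \<in> m \<Longrightarrow> a \<in> m"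
  by (induction n) (use m_one m_prime V.power_closed in auto)

lemma m_sum: "(\<And>i. i \<in> I \<Longrightarrow> f i \<in> m) \<Longrightarrow> sum f I \<in> m"
  by (induction I rule: infinite_finite_induct) (auto intro: m_zero m_add)

lemma poly_mem_m: "p \<in> polys m \<Longrightarrow> a \<in> V \<Longrightarrow> poly p a \<in> m"
  unfolding poly_altdef polys_iff
  by (intro m_sum) (metis m_mult mult.commute V.power_closed)

lemma polys_mono: "B \<subseteq> C \<Longrightarrow> polys B \<subseteq> polys C" for B C :: "'a set"
  by (meson polys_iff subset_iff)

lemma power_diff_mem: "a \<in> V \<Longrightarrow> b \<in> V \<Longrightarrow> a - b \<in> m \<Longrightarrow> a ^ n - b ^ n \<in> m"
proof (induction n)
  case (Suc n)
  have "a ^ Suc n - b ^ Suc n = a * (a ^ n - b ^ n) + b ^ n * (a - b)"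
    by (simp add: algebra_simps)
  also have "\<dots> \<in> m"
    using Suc by (intro m_add m_mult V.power_closed) auto
  finally show ?case .
qed (auto intro: m_zero)

text \<open>In the domain \<open>V/m\<close>, a polynomial with more roots than its degree is zero.
  The induction splits off one linear factor: \<open>(s - t) * poly g s\<close> is congruent to 0,
  and primality of \<open>m\<close> cancels \<open>s - t\<close>.\<close>

lemma coeffs_mem_m_if_roots:
  assumes "finite T" "T \<subseteq> V" "\<And>s t. s \<in> T \<Longrightarrow> t \<in> T \<Longrightarrow> s \<noteq> t \<Longrightarrow> s - t \<notin> m"
    and "f \<in> polys V" "\<And>t. t \<in> T \<Longrightarrow> poly f t \<in> m" "\<And>i. i \<ge> card T \<Longrightarrow> Polynomial.coeff f i = 0"
  shows "f \<in> polys m"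
  using assms
proof (induction T arbitrary: f rule: finite_induct)
  case empty
  then have "f = 0" by (intro poly_eqI) auto
  then show ?case by (simp add: polys_iff m_zero)
next
  case (insert t T)
  define g where "g = synthetic_div f t"
  have t: "t \<in> V" and T: "T \<subseteq> V" using insert.prems by auto
  have g: "g \<in> polys V" unfolding g_def using insert.prems t by (intro V.synthetic_div_polys) auto
  have f: "f = [:- t, 1:] * g + [:poly f t:]"
    unfolding g_def using synthetic_div_correct'[of t f] by simp
  have "g \<in> polys m"
  proof (rule insert.IH)
    show "Polynomial.coeff g i = 0" if "i \<ge> card T" for i
    proof -
      have "f = 0 \<or> Polynomial.degree f \<le> card T"
        using insert.prems(5)[of "Polynomial.degree f"] insert.hyps
        by (metis card_insert_disjoint leading_coeff_0_iff not_less_eq_eq)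
      hence "g = 0 \<or> Polynomial.degree g < card T"
        using synthetic_div_eq_0_iff[of f t] unfolding g_def
        by (cases "Polynomial.degree f = 0") (auto simp: degree_synthetic_div)
      thus ?thesis using that by (auto simp: coeff_eq_0)
    qed
    show "poly g s \<in> m" if s: "s \<in> T" for s
    proof -
      have "(s - t) * poly g s = poly f s - poly f t"
        using arg_cong[OF f, of "\<lambda>p. poly p s"] by (simp add: algebra_simps)
      also have "\<dots> \<in> m" using insert.prems s by (intro m_diff) auto
      finally have "s - t \<in> m \<or> poly g s \<in> m"
        using s T t g by (intro m_prime V.diff_closed V.poly_closed) auto
      moreover have "s - t \<notin> m" using insert.prems(2)[of s t] insert.hyps s by auto
      ultimately show ?thesis by blast
    qed
  qed (use insert.prems g in auto)
  moreover have "[:poly f t:] \<in> polys m"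
    using insert.prems(4)[of t] by (auto simp: polys_iff coeff_pCons m_zero split: nat.split)
  ultimately show ?case
    using t insert.prems
    by (subst f) (auto simp: polys_iff coeff_pCons m_zero split: nat.split intro!: m_add m_diff m_mult)
qed


text \<open>This says that the residue of \<theta> has degree l over that of \<open>A\<close>. If it
  had degree \<open>d < l\<close>, its minimal polynomial would divide
  \<open>X^l - \<theta>^l\<close>, whose roots are the \<open>\<zeta>^i \<theta>\<close>. The
  constant term would put \<open>\<theta>^d\<close> into \<open>A\<close> modulo \<open>m\<close>,
  and then \<theta> as well, since \<open>d\<close> is prime to \<open>l\<close>.\<close>

lemma kummer_independent:
  assumes l: "prime l" and \<theta>: "\<theta> \<in> V" "\<theta> \<notin> m" "\<theta> ^ l \<in> A"
    and \<zeta>: "\<zeta> \<in> A" "\<zeta> ^ l = 1" "\<And>i. 0 < i \<Longrightarrow> i < l \<Longrightarrow> \<zeta> ^ i - 1 \<notin> m"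
    and no_root: "\<And>b. b \<in> A \<Longrightarrow> \<theta> - b \<notin> m"
    and p: "p \<in> polys A" "\<And>i. i \<ge> l \<Longrightarrow> Polynomial.coeff p i = 0" "poly p \<theta> \<in> m"
  shows "p \<in> polys m"
proof -
  have A_V: "p \<in> polys V" if "p \<in> polys A" for p
    using that polys_mono[OF subset(1)] by blast
  have l0: "l > 1" using l by (rule prime_gt_1_nat)
  have \<zeta>V: "\<zeta> \<in> V" using \<zeta> subset by auto
  \<comment> \<open>The least degree in \<open>P\<close> plays the role of the degree of the minimal
    polynomial of the residue of \<theta>.\<close>
  define P where "P = {p \<in> polys A. Polynomial.lead_coeff p = 1 \<and> poly p \<theta> \<in> m}"
  define F where "F = Polynomial.monom 1 l - [:\<theta> ^ l:]"
  have F: "F \<in> polys A"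
    unfolding F_def by (intro A.polys_closed A.monom_polys A.const_polys A.closed \<theta>)
  have degF: "Polynomial.degree F = l"
    using l0 degree_add_eq_left[of "- [:\<theta> ^ l:]" "Polynomial.monom 1 l"]
    by (simp add: F_def degree_monom_eq del: minus_pCons)
  have "F \<in> P"
    using F degF l0 unfolding P_def
    by (auto simp: F_def poly_monom m_zero coeff_pCons split: nat.split)
  then obtain g where gP: "g \<in> P" and least: "\<And>h. h \<in> P \<Longrightarrow> Polynomial.degree g \<le> Polynomial.degree h"
    using ex_has_least_nat[of "\<lambda>h. h \<in> P" F Polynomial.degree] by blast
  define d where "d = Polynomial.degree g"
  have g: "g \<in> polys A" "Polynomial.lead_coeff g = 1" "poly g \<theta> \<in> m"
    using gP by (auto simp: P_def)
  \<comment> \<open>Minimality of \<open>d\<close> concerns monic polynomials only. A counterexample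
    \<open>f\<close> is cut off above its last coefficient outside \<open>m\<close>, which loses
    only terms in \<open>m\<close>; that coefficient is a unit of \<open>A\<close>, so the rest can
    be scaled to a monic polynomial of degree below \<open>d\<close>.\<close>
  have reduce: "f \<in> polys m"
    if f: "f \<in> polys A" "\<And>i. i \<ge> d \<Longrightarrow> Polynomial.coeff f i = 0" "poly f \<theta> \<in> m" for f
  proof (rule ccontr)
    assume "f \<notin> polys m"
    define n where "n = Max {i. Polynomial.coeff f i \<notin> m}"
    have "{i. Polynomial.coeff f i \<notin> m} \<subseteq> {..<d}"
      using f(2) m_zero by (metis (mono_tags, lifting) lessThan_iff linorder_not_less mem_Collect_eq subsetI)
    hence fin: "finite {i. Polynomial.coeff f i \<notin> m}" by (rule finite_subset) auto
    have n: "Polynomial.coeff f n \<notin> m"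
      using Max_in[OF fin] \<open>f \<notin> polys m\<close> unfolding n_def polys_iff by auto
    have gt: "Polynomial.coeff f i \<in> m" if "i > n" for i
      using Max_ge[OF fin, of i] that unfolding n_def by (meson linorder_not_less mem_Collect_eq)
    have nd: "n < d" using n f(2)[of n] m_zero by (metis linorder_not_less)
    define c where "c = inverse (Polynomial.coeff f n)"
    have c: "c \<in> A" unfolding c_def using f n by (intro unit) (auto simp: polys_iff)
    have c1: "c * Polynomial.coeff f n = 1" using n m_zero unfolding c_def by (metis left_inverse)
    define h where "h = Polynomial.smult c (poly_cutoff (Suc n) f)"
    have coeff_h: "Polynomial.coeff h i = (if i \<le> n then c * Polynomial.coeff f i else 0)" for i
      unfolding h_def by (auto simp: coeff_poly_cutoff)
    have "Polynomial.degree h \<le> n"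
      by (rule degree_le) (auto simp: coeff_h)
    moreover have "Polynomial.degree h \<ge> n"
      by (rule le_degree) (simp add: coeff_h c1)
    ultimately have degh: "Polynomial.degree h = n" by simp
    have hA: "h \<in> polys A"
      using f c by (auto simp: polys_iff coeff_h intro!: A.closed)
    have "Polynomial.smult c f - h \<in> polys m"
      using c subset gt f(1) by (auto simp: polys_iff coeff_h m_zero intro!: m_mult)
    from poly_mem_m[OF this \<theta>(1)] have "c * poly f \<theta> - poly h \<theta> \<in> m" by simp
    moreover have "c * poly f \<theta> \<in> m" using c f subset by (intro m_mult) auto
    ultimately have "poly h \<theta> \<in> m" using m_diff_iff by blast
    hence "h \<in> P" using hA degh by (simp add: P_def coeff_h c1)
    from least[OF this] show False using degh nd d_def by simp
  qed
  have "d = l"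
  proof (rule ccontr)
    assume "d \<noteq> l"
    with least[OF \<open>F \<in> P\<close>] degF d_def have dl: "d < l" by simp
    have d0: "d > 0"
    proof (rule ccontr)
      assume "\<not> d > 0"
      hence "g = [:1:]" using g(2) unfolding d_def by (metis degree_eq_zeroE gr0I lead_coeff_pCons(2))
      with g(3) m_one show False by simp
    qed
    \<comment> \<open>By \<open>reduce\<close> the remainder is zero modulo \<open>m\<close>, so
      \<open>g\<close> divides \<open>F\<close> modulo \<open>m\<close> and every
      \<open>\<rho> i\<close> is a root of \<open>g\<close> or of the cofactor
      \<open>q\<close>.\<close>
    from A.monic_division[OF g(1,2) F] obtain q r where q: "q \<in> polys A" and r: "r \<in> polys A"
      and Fqr: "F = g * q + r" and r0: "\<And>i. i \<ge> d \<Longrightarrow> Polynomial.coeff r i = 0"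
      unfolding d_def by blast
    have "poly F \<theta> = 0" by (simp add: F_def poly_monom)
    hence "poly r \<theta> = - (poly q \<theta> * poly g \<theta>)"
      unfolding Fqr by (simp add: add_eq_0_iff mult.commute)
    also have "\<dots> \<in> m" using q \<theta> g by (intro m_uminus m_mult V.poly_closed A_V)
    finally have rm: "r \<in> polys m" using reduce r r0 by blast
    have degr: "Polynomial.degree r < d"
      using r0 d0 by (metis degree_0 leading_coeff_0_iff linorder_not_less)
    have deggq: "Polynomial.degree (g * q) = l"
      using degF degr dl Fqr degree_add_eq_left[of "- r" F] by simp
    hence "q \<noteq> 0" using l0 by auto
    moreover have "g \<noteq> 0" using g by auto
    ultimately have degq: "Polynomial.degree q = l - d"
      using deggq by (simp add: degree_mult_eq d_def)
    have "Polynomial.lead_coeff (g * q) = 1"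
      using degF \<open>F \<in> P\<close> degr dl deggq unfolding P_def Fqr by (auto simp: coeff_eq_0)
    hence leadq: "Polynomial.lead_coeff q = 1" using g(2) by (simp add: lead_coeff_mult)
    define \<rho> where "\<rho> i = \<zeta> ^ i * \<theta>" for i
    have \<rho>V: "\<rho> i \<in> V" for i unfolding \<rho>_def by (intro V.closed \<zeta>V \<theta>)
    have \<zeta>m: "\<zeta> ^ i \<notin> m" for i
    proof
      assume "\<zeta> ^ i \<in> m"
      hence "\<zeta> \<in> m" using m_power \<zeta>V by blast
      hence "\<zeta> ^ (l - 1) * \<zeta> \<in> m" using \<zeta>V by (intro m_mult V.closed)
      thus False using \<zeta>(2) l0 m_one by (metis One_nat_def Suc_pred mult.commute order_less_trans power_Suc zero_less_one)
    qed
    have dist: "\<rho> i - \<rho> j \<notin> m" if "j < i" "i < l" for i j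
    proof
      assume "\<rho> i - \<rho> j \<in> m"
      also have "\<rho> i - \<rho> j = \<zeta> ^ j * ((\<zeta> ^ (i - j) - 1) * \<theta>)"
        unfolding \<rho>_def using that by (simp add: algebra_simps flip: power_add)
      finally have "\<zeta> ^ j \<in> m \<or> (\<zeta> ^ (i - j) - 1) * \<theta> \<in> m"
        by (rule m_prime[rotated 2]) (intro V.closed \<zeta>V \<theta>)+
      hence "(\<zeta> ^ (i - j) - 1) * \<theta> \<in> m" using \<zeta>m by blast
      hence "\<zeta> ^ (i - j) - 1 \<in> m \<or> \<theta> \<in> m"
        by (rule m_prime[rotated 2]) (intro V.closed \<zeta>V \<theta>)+
      thus False using \<zeta>(3)[of "i - j"] \<theta>(2) that by auto
    qed
    hence dist': "\<rho> i - \<rho> j \<notin> m" if "j < l" "i < l" "i \<noteq> j" for i j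
      using that m_uminus[of "\<rho> i - \<rho> j"] by (metis linorder_neqE_nat minus_diff_eq)
    have inj: "inj_on \<rho> {..<l}"
      using dist' m_zero by (intro inj_onI) (metis diff_self lessThan_iff)
    have split: "poly g (\<rho> i) \<in> m \<or> poly q (\<rho> i) \<in> m" for i
    proof -
      have "poly F (\<rho> i) = 0"
      proof -
        have "(\<zeta> ^ i) ^ l = 1" using \<zeta>(2) by (metis mult.commute power_mult power_one)
        thus ?thesis by (simp add: F_def poly_monom \<rho>_def power_mult_distrib)
      qed
      hence "poly g (\<rho> i) * poly q (\<rho> i) = - poly r (\<rho> i)"
        unfolding Fqr by (simp add: add_eq_0_iff2)
      also have "\<dots> \<in> m" by (intro m_uminus poly_mem_m rm \<rho>V)
      finally show ?thesis by (rule m_prime[rotated 2]) (intro V.poly_closed A_V g q \<rho>V)+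
    qed
    define S where "S = {i. i < l \<and> poly g (\<rho> i) \<in> m}"
    define T where "T = {i. i < l \<and> poly q (\<rho> i) \<in> m}"
    \<comment> \<open>\<open>q\<close> is monic of degree \<open>l - d\<close>, so it cannot vanish
      at more than \<open>l - d\<close> of the incongruent \<open>\<rho> i\<close>. At least
      \<open>d\<close> of them are left as roots of \<open>g\<close>.\<close>
    have cardT: "card T \<le> l - d"
    proof (rule ccontr)
      assume "\<not> card T \<le> l - d"
      have inj: "inj_on \<rho> T" using inj by (rule inj_on_subset) (auto simp: T_def)
      have "q \<in> polys m"
      proof (rule coeffs_mem_m_if_roots[of "\<rho> ` T"])
        show "Polynomial.coeff q i = 0" if "i \<ge> card (\<rho> ` T)" for i
          using that \<open>\<not> card T \<le> l - d\<close> degq by (simp add: card_image[OF inj] coeff_eq_0)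
      qed (use dist' \<rho>V A_V q in \<open>auto simp: T_def\<close>)
      thus False using leadq m_one unfolding polys_iff by metis
    qed
    have "S \<union> T = {..<l}" using split by (auto simp: S_def T_def)
    hence "l \<le> card S + card T" using card_Un_le[of S T] by simp
    hence "d \<le> card S" using cardT dl by simp
    then obtain S' where S': "S' \<subseteq> S" "card S' = d" "finite S'"
      using obtain_subset_with_card_n by metis
    \<comment> \<open>\<open>g\<close> and the product are monic of the same degree \<open>d\<close>
      and share \<open>d\<close> incongruent roots, so their difference is zero modulo
      \<open>m\<close>.\<close>
    define h where "h = g - (\<Prod>i\<in>S'. [:- \<rho> i, 1:])"
    have degprod: "Polynomial.degree (\<Prod>i\<in>S'. [:- \<rho> i, 1:]) = d"
      by (subst degree_prod_eq_sum_degree) (auto simp: S')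
    have hm: "h \<in> polys m"
    proof (rule coeffs_mem_m_if_roots[of "\<rho> ` S'"])
      have inj: "inj_on \<rho> S'" using inj by (rule inj_on_subset) (use S' in \<open>auto simp: S_def\<close>)
      show "Polynomial.coeff h i = 0" if "i \<ge> card (\<rho> ` S')" for i
      proof (cases "i = d")
        case True
        have "Polynomial.lead_coeff (\<Prod>i\<in>S'. [:- \<rho> i, 1:]) = 1"
          by (simp add: lead_coeff_prod)
        then show ?thesis using g(2) degprod True by (simp add: h_def d_def)
      next
        case False
        with that have "i > d" using S' by (simp add: card_image[OF inj])
        then show ?thesis using degprod by (simp add: h_def coeff_eq_0 d_def)
      qed
      show "h \<in> polys V" unfolding h_def
        by (intro V.polys_closed V.linear_polys A_V g \<rho>V)
      show "poly h t \<in> m" if "t \<in> \<rho> ` S'" for t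
      proof -
        have "poly (\<Prod>i\<in>S'. [:- \<rho> i, 1:]) t = 0"
          using that S'(3) by (auto simp: poly_prod)
        then show ?thesis using that S'(1) by (auto simp: h_def S_def)
      qed
      show "s - t \<notin> m" if "s \<in> \<rho> ` S'" "t \<in> \<rho> ` S'" "s \<noteq> t" for s t
        using that S'(1) dist' unfolding S_def by blast
    qed (use S' \<rho>V in auto)
    \<comment> \<open>Comparison of constant terms: up to sign and a power of \<zeta>,
      \<open>\<theta>^d\<close> is congruent to the constant term of \<open>g\<close>.\<close>
    define N where "N = (\<Sum>i\<in>S'. i)"
    have "poly (\<Prod>i\<in>S'. [:- \<rho> i, 1:]) 0 = (\<Prod>i\<in>S'. (- 1) * \<zeta> ^ i * \<theta>)"
      by (simp add: poly_prod \<rho>_def)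
    also have "\<dots> = (- 1) ^ d * \<zeta> ^ N * \<theta> ^ d"
      unfolding prod.distrib using S' by (simp add: N_def power_sum)
    finally have "poly h 0 = poly g 0 - (- 1) ^ d * \<zeta> ^ N * \<theta> ^ d" by (simp add: h_def)
    moreover have "poly h 0 \<in> m" using hm V.zero_closed by (rule poly_mem_m)
    ultimately have const: "poly g 0 - (- 1) ^ d * \<zeta> ^ N * \<theta> ^ d \<in> m" by simp
    \<comment> \<open>The inverse of the factor \<open>(-1)^d \<zeta>^N\<close>, written without
      division so that it visibly lies in \<open>A\<close>.\<close>
    define u where "u = (- 1) ^ d * (\<zeta> ^ N) ^ (l - 1)"
    have uA: "u \<in> A" unfolding u_def by (intro A.closed \<zeta>)
    have "\<zeta> ^ N * (\<zeta> ^ N) ^ (l - 1) = 1"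
      using l0 \<zeta>(2) by (metis One_nat_def Suc_pred mult.commute order_less_trans power_Suc power_mult power_one zero_less_one)
    moreover have "(- 1) ^ d * (- 1) ^ d = (1::'a)"
      by (simp flip: power_mult_distrib)
    ultimately have u1: "u * ((- 1) ^ d * \<zeta> ^ N) = 1"
      unfolding u_def by (simp add: ac_simps)
    define b where "b = u * poly g 0"
    have bA: "b \<in> A" unfolding b_def by (intro A.closed uA A.poly_closed g)
    have "u * (poly g 0 - (- 1) ^ d * \<zeta> ^ N * \<theta> ^ d) \<in> m"
      using const uA subset by (intro m_mult) auto
    also have "u * (poly g 0 - (- 1) ^ d * \<zeta> ^ N * \<theta> ^ d) = b - u * ((- 1) ^ d * \<zeta> ^ N) * \<theta> ^ d"
      by (simp add: b_def algebra_simps)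
    finally have b: "\<theta> ^ d - b \<in> m" unfolding u1 using m_uminus by fastforce
    \<comment> \<open>Some power of \<open>\<theta>^d\<close> is \<theta> times a power of
      \<open>\<theta>^l\<close>, and the latter is a unit of \<open>A\<close>. So \<theta> is
      congruent to an element of \<open>A\<close>, against \<open>no_root\<close>.\<close>
    have "coprime d l"
      using l d0 dl by (metis coprime_commute nat_dvd_not_less prime_imp_coprime)
    then obtain e f where ef: "d * e = l * f + 1"
      using coprime_bezout_strong[of d l] l0 by auto
    have "(\<theta> ^ d) ^ e - b ^ e \<in> m"
      using b bA subset \<theta> by (intro power_diff_mem V.closed) auto
    also have "(\<theta> ^ d) ^ e = (\<theta> ^ l) ^ f * \<theta>"
      by (simp flip: power_mult add: ef)
    finally have *: "(\<theta> ^ l) ^ f * \<theta> - b ^ e \<in> m" .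
    have "\<theta> ^ (l * f) \<notin> m" using m_power \<theta> by blast
    hence af: "(\<theta> ^ l) ^ f \<notin> m" by (simp add: power_mult)
    define v where "v = inverse ((\<theta> ^ l) ^ f)"
    have v: "v \<in> A" unfolding v_def by (intro unit A.power_closed[of "\<theta> ^ l"] \<theta> af)
    have v1: "v * (\<theta> ^ l) ^ f = 1" unfolding v_def using af m_zero by (metis left_inverse)
    have "v * ((\<theta> ^ l) ^ f * \<theta> - b ^ e) \<in> m"
      using * v subset by (intro m_mult) auto
    also have "v * ((\<theta> ^ l) ^ f * \<theta> - b ^ e) = (v * (\<theta> ^ l) ^ f) * \<theta> - v * b ^ e"
      by (simp only: right_diff_distrib mult.assoc)
    finally have "\<theta> - v * b ^ e \<in> m" unfolding v1 by simp
    moreover have "v * b ^ e \<in> A" by (intro A.closed v bA)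
    ultimately show False using no_root by blast
  qed
  with reduce p show ?thesis by blast
qed

end


section \<open>Kummer extensions of prime degree\<close>

abbreviation type_ring :: "'a::comm_ring_1 ring" where
  "type_ring \<equiv> ring_of_type_algebra"

lemma type_ring_simps [simp]:
  "carrier type_ring = UNIV" "a \<otimes>\<^bsub>type_ring\<^esub> b = a * b" "a \<oplus>\<^bsub>type_ring\<^esub> b = a + b"
  "\<one>\<^bsub>type_ring\<^esub> = 1" "\<zero>\<^bsub>type_ring\<^esub> = 0"
  by (simp_all add: ring_of_type_algebra_def)

lemma type_ring_uminus [simp]: "\<ominus>\<^bsub>type_ring\<^esub> a = - a"
proof -
  interpret ring "type_ring :: 'a ring" ..
  show ?thesis by (rule minus_equality) auto
qed

lemma type_ring_inverse: "inv\<^bsub>type_ring\<^esub> a = inverse a" if "a \<noteq> 0" for a :: "'a::field"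
proof -
  interpret field "type_ring :: 'a ring" ..
  show ?thesis by (rule comm_inv_char) (use that in auto)
qed

text \<open>Subfields expressed in the operations of the type, so that type class arithmetic applies
  directly; \<open>subfield_type_ring_iff\<close> translates to the record-based notion.\<close>

locale field_subset = unital_subring M for M :: "'a::field set" +
  assumes inverse_closed: "a \<in> M \<Longrightarrow> inverse a \<in> M"
begin

lemma divide_closed: "a \<in> M \<Longrightarrow> b \<in> M \<Longrightarrow> a / b \<in> M"
  by (simp add: divide_inverse inverse_closed mult_closed)

lemmas field_closed = closed inverse_closed divide_closed

end

lemma subfield_type_ring_iff: "subfield M type_ring \<longleftrightarrow> field_subset M"
  for M :: "'a::field set"
proof -
  interpret field "type_ring :: 'a ring" ..
  show ?thesis
  proof
    assume M: "subfield M type_ring"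
    note closed = subringE [OF subfieldE(1) [OF M]]
    show "field_subset M"
    proof unfold_locales
      show "inverse a \<in> M" if "a \<in> M" for a
        using subfield_m_inv(1) [OF M, of a] closed(2) that
        by (cases "a = 0") (auto simp: type_ring_inverse)
    qed (use closed in auto)
  next
    assume "field_subset M"
    then interpret field_subset M .
    show "subfield M type_ring"
    proof (rule subfieldI')
      show "subring M type_ring"
        by (rule subringI) (auto intro: closed)
    qed (auto simp: type_ring_inverse intro: inverse_closed)
  qed
qed

text \<open>A homomorphism is a total function constrained only on \<open>M\<close>. Restricting it
  to a smaller field then changes nothing but the domain in the predicate, and the codomain is the
  whole type.\<close>

locale subset_hom = field_subset M for M :: "'a::field set" +
  fixes \<sigma> :: "'a \<Rightarrow> 'b::field"
  assumes hom_add: "a \<in> M \<Longrightarrow> b \<in> M \<Longrightarrow> \<sigma> (a + b) = \<sigma> a + \<sigma> b"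
    and hom_mult: "a \<in> M \<Longrightarrow> b \<in> M \<Longrightarrow> \<sigma> (a * b) = \<sigma> a * \<sigma> b"
    and hom_one: "\<sigma> 1 = 1"
begin

lemma hom_zero: "\<sigma> 0 = 0"
  using hom_add[OF zero_closed zero_closed] by (metis add.right_neutral add_left_cancel)

lemma hom_uminus: "a \<in> M \<Longrightarrow> \<sigma> (- a) = - \<sigma> a"
  using hom_add[of a "- a"] hom_zero uminus_closed by (simp add: eq_neg_iff_add_eq_0 add.commute)

lemma hom_diff: "a \<in> M \<Longrightarrow> b \<in> M \<Longrightarrow> \<sigma> (a - b) = \<sigma> a - \<sigma> b"
  using hom_add[of a "- b"] hom_uminus uminus_closed by simp

lemma hom_eq_0_iff: "a \<in> M \<Longrightarrow> \<sigma> a = 0 \<longleftrightarrow> a = 0"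
  using hom_mult[of a "inverse a"] hom_zero hom_one inverse_closed by (cases "a = 0") auto

lemma hom_inverse: "a \<in> M \<Longrightarrow> \<sigma> (inverse a) = inverse (\<sigma> a)"
  using hom_mult[of a "inverse a"] hom_zero hom_one inverse_closed hom_eq_0_iff[of a]
  by (cases "a = 0") (auto intro: inverse_unique[symmetric])

lemma hom_divide: "a \<in> M \<Longrightarrow> b \<in> M \<Longrightarrow> \<sigma> (a / b) = \<sigma> a / \<sigma> b"
  by (simp add: divide_inverse hom_mult hom_inverse inverse_closed)

lemma hom_inj: "inj_on \<sigma> M"
  by (rule inj_onI) (metis hom_diff hom_eq_0_iff diff_closed eq_iff_diff_eq_0)

lemma hom_power: "a \<in> M \<Longrightarrow> \<sigma> (a ^ n) = \<sigma> a ^ n"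
  by (induction n) (auto simp: hom_one hom_mult power_closed)

lemma hom_sum: "(\<And>i. i \<in> I \<Longrightarrow> f i \<in> M) \<Longrightarrow> \<sigma> (sum f I) = (\<Sum>i\<in>I. \<sigma> (f i))"
  by (induction I rule: infinite_finite_induct) (auto simp: hom_zero hom_add sum_closed)

lemma hom_prod: "(\<And>i. i \<in> I \<Longrightarrow> f i \<in> M) \<Longrightarrow> \<sigma> (prod f I) = (\<Prod>i\<in>I. \<sigma> (f i))"
  by (induction I rule: infinite_finite_induct) (auto simp: hom_one hom_mult prod_closed)

lemmas coeff_map_hom = coeff_map_poly[of \<sigma>, OF hom_zero]

lemma map_poly_hom_diff:
  "p \<in> polys M \<Longrightarrow> q \<in> polys M \<Longrightarrow> map_poly \<sigma> (p - q) = map_poly \<sigma> p - map_poly \<sigma> q"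
  by (intro poly_eqI) (auto simp: coeff_map_hom polys_iff hom_diff)

lemma map_poly_hom_add:
  "p \<in> polys M \<Longrightarrow> q \<in> polys M \<Longrightarrow> map_poly \<sigma> (p + q) = map_poly \<sigma> p + map_poly \<sigma> q"
  by (intro poly_eqI) (auto simp: coeff_map_hom polys_iff hom_add)

lemma map_poly_hom_mult:
  "p \<in> polys M \<Longrightarrow> q \<in> polys M \<Longrightarrow> map_poly \<sigma> (p * q) = map_poly \<sigma> p * map_poly \<sigma> q"
  by (intro poly_eqI) (auto simp: coeff_map_hom polys_iff coeff_mult hom_sum hom_mult closed)

lemma map_poly_hom_one: "map_poly \<sigma> 1 = 1"
  by (intro poly_eqI) (auto simp: coeff_map_hom hom_one hom_zero coeff_1)

lemma map_poly_hom_prod: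
  "(\<And>i. i \<in> I \<Longrightarrow> f i \<in> polys M) \<Longrightarrow> map_poly \<sigma> (prod f I) = (\<Prod>i\<in>I. map_poly \<sigma> (f i))"
  by (induction I rule: infinite_finite_induct)
    (auto simp: map_poly_hom_one map_poly_hom_mult polys_closed)

lemma map_poly_hom_pCons: "map_poly \<sigma> (pCons a p) = pCons (\<sigma> a) (map_poly \<sigma> p)"
  by (intro poly_eqI) (auto simp: coeff_map_hom coeff_pCons split: nat.split)

lemma poly_map_hom: "p \<in> polys M \<Longrightarrow> a \<in> M \<Longrightarrow> poly (map_poly \<sigma> p) (\<sigma> a) = \<sigma> (poly p a)"
proof (induction p)
  case 0
  then show ?case by (simp add: hom_zero)
next
  case (pCons b p)
  have "b \<in> M" "p \<in> polys M"
    using pCons.prems unfolding polys_iff by (metis coeff_pCons_0, metis coeff_pCons_Suc)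
  then show ?case
    using pCons by (simp add: map_poly_hom_pCons hom_add hom_mult poly_closed mult_closed)
qed

lemma subset_hom_subset: "field_subset N \<Longrightarrow> N \<subseteq> M \<Longrightarrow> subset_hom N \<sigma>"
  by (intro subset_hom.intro subset_hom_axioms.intro) (auto intro: hom_add hom_mult hom_one)

lemma field_subset_image: "field_subset (\<sigma> ` M)"
proof unfold_locales
  show "0 \<in> \<sigma> ` M" "1 \<in> \<sigma> ` M"
    using hom_zero hom_one closed(1,2) by (metis image_eqI)+
  fix a b assume "a \<in> \<sigma> ` M"
  then obtain a' where a: "a' \<in> M" "a = \<sigma> a'" by blast
  show "- a \<in> \<sigma> ` M" "inverse a \<in> \<sigma> ` M"
    using a by (simp_all flip: hom_uminus hom_inverse add: uminus_closed inverse_closed)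
  assume "b \<in> \<sigma> ` M"
  then obtain b' where b: "b' \<in> M" "b = \<sigma> b'" by blast
  show "a + b \<in> \<sigma> ` M" "a * b \<in> \<sigma> ` M"
    using a b by (simp_all flip: hom_add hom_mult add: add_closed mult_closed)
qed

end

text \<open>Since \<zeta> lies in \<open>M\<close>, a \<theta> outside \<open>M\<close> means that
  no l-th root of \<open>\<theta>^l\<close> lies in \<open>M\<close>; for prime \<open>l\<close>
  this is the classical criterion for \<open>X^l - \<theta>^l\<close> to be irreducible.\<close>

locale kummer_step = field_subset M for M :: "'a::field set" +
  fixes l :: nat and \<zeta> \<theta> :: 'a
  assumes l: "prime l"
    and \<zeta>: "\<zeta> \<in> M" "\<zeta> ^ l = 1" "\<And>i. 0 < i \<Longrightarrow> i < l \<Longrightarrow> \<zeta> ^ i \<noteq> 1"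
    and \<theta>: "\<theta> ^ l \<in> M" "\<theta> \<notin> M"
    and algebraic: "(ring.algebraic type_ring over M) \<theta>"
begin

definition E :: "'a set" where
  "E = ring.simple_extension type_ring M \<theta>"

definition F :: "'a poly" where
  "F = Polynomial.monom 1 l - [:\<theta> ^ l:]"

lemma l_gt_1: "l > 1"
  using l by (rule prime_gt_1_nat)

lemma theta_nonzero: "\<theta> \<noteq> 0"
  using \<theta>(2) zero_closed by auto

lemma F_poly: "F \<in> polys M"
  unfolding F_def by (intro polys_closed monom_polys const_polys closed \<theta>)

lemma degree_F: "Polynomial.degree F = l"
  using l_gt_1 degree_add_eq_left[of "- [:\<theta> ^ l:]" "Polynomial.monom 1 l"]
  by (simp add: F_def degree_monom_eq del: minus_pCons)

lemma monic_F: "Polynomial.lead_coeff F = 1"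
  unfolding degree_F using l_gt_1 by (simp add: F_def coeff_pCons split: nat.split)

lemma poly_F: "poly F a = a ^ l - \<theta> ^ l"
  by (simp add: F_def poly_monom)

lemma field_subset_E: "field_subset E"
proof -
  interpret R: field "type_ring :: 'a ring" ..
  have "subfield M type_ring"
    by (simp add: subfield_type_ring_iff field_subset_axioms)
  from R.simple_extension_is_subfield[OF this, of \<theta>] algebraic show ?thesis
    by (simp add: subfield_type_ring_iff E_def)
qed

sublocale E: field_subset E
  by (rule field_subset_E)

lemma M_subset_E: "M \<subseteq> E" and theta_mem_E: "\<theta> \<in> E"
proof -
  interpret R: field "type_ring :: 'a ring" ..
  have M: "subfield M type_ring"
    by (simp add: subfield_type_ring_iff field_subset_axioms)
  show "M \<subseteq> E" unfolding E_def by (rule R.simple_extension_incl) auto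
  show "\<theta> \<in> E" unfolding E_def
    by (rule R.simple_extension_mem) (use subfieldE(1)[OF M] in auto)
qed

lemma E_subset: "field_subset N \<Longrightarrow> M \<subseteq> N \<Longrightarrow> \<theta> \<in> N \<Longrightarrow> E \<subseteq> N"
proof -
  assume N: "field_subset N" "M \<subseteq> N" "\<theta> \<in> N"
  interpret R: field "type_ring :: 'a ring" ..
  interpret N: field_subset N by (rule N)
  show "E \<subseteq> N"
  proof
    fix u assume "u \<in> E"
    then show "u \<in> N" unfolding E_def
      by (induction rule: R.simple_extension.induct) (use N in \<open>auto intro!: N.closed\<close>)
  qed
qed

lemma E_eq_poly: "u \<in> E \<Longrightarrow> \<exists>p\<in>polys M. u = poly p \<theta>"
proof -
  interpret R: field "type_ring :: 'a ring" ..
  assume "u \<in> E"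
  then show ?thesis unfolding E_def
  proof (induction rule: R.simple_extension.induct)
    case zero
    have "0 \<in> polys M" by (intro polys_closed)
    then show ?case by (intro bexI[of _ 0]) auto
  next
    case (lin k1 k2)
    then obtain p where "p \<in> polys M" "k1 = poly p \<theta>" by blast
    then show ?case using lin by (intro bexI[of _ "pCons k2 p"]) (auto intro: pCons_polys)
  qed
qed

lemma E_rep:
  assumes "u \<in> E"
  shows "\<exists>p\<in>polys M. (\<forall>i\<ge>l. Polynomial.coeff p i = 0) \<and> u = poly p \<theta>"
proof -
  obtain p where p: "p \<in> polys M" "u = poly p \<theta>" using E_eq_poly[OF assms] by blast
  from monic_division[OF F_poly monic_F p(1)] obtain q r where
    "r \<in> polys M" "p = F * q + r" "\<forall>i\<ge>l. Polynomial.coeff r i = 0"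
    unfolding degree_F by blast
  then show ?thesis using p(2) by (intro bexI[of _ r]) (auto simp: poly_F)
qed

text \<open>The case \<open>m = {0}\<close> and \<open>V = UNIV\<close> of
  \<open>kummer_independent\<close>, where congruence is equality and
  \<open>\<theta> \<notin> M\<close> is the condition \<open>no_root\<close>.\<close>

lemma independent:
  assumes "p \<in> polys M" "\<And>i. i \<ge> l \<Longrightarrow> Polynomial.coeff p i = 0" "poly p \<theta> = 0"
  shows "p = 0"
proof -
  interpret local_pair UNIV M "{0}"
    by unfold_locales (auto intro: inverse_closed)
  have "p \<in> polys {0}"
  proof (rule kummer_independent[OF l _ _ \<theta>(1) \<zeta>(1,2)])
    show "\<theta> - b \<notin> {0}" if "b \<in> M" for b using that \<theta>(2) by auto
  qed (use assms \<zeta>(3) theta_nonzero in auto)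
  then show ?thesis by (intro poly_eqI) (auto simp: polys_iff)
qed

lemma F_dvd:
  assumes "p \<in> polys M" "poly p \<theta> = 0"
  shows "\<exists>q\<in>polys M. p = F * q"
proof -
  from monic_division[OF F_poly monic_F assms(1)] obtain q r where qr:
    "q \<in> polys M" "r \<in> polys M" "p = F * q + r" "\<forall>i\<ge>l. Polynomial.coeff r i = 0"
    unfolding degree_F by blast
  have "poly r \<theta> = 0" using assms(2) qr(3) by (simp add: poly_F)
  then have "r = 0" using independent qr by blast
  with qr show ?thesis by auto
qed

text \<open>\<open>E\<close> is \<open>M[X]\<close> modulo \<open>F\<close>, so \<theta> may be sent
  to any root of the image of \<open>F\<close>. The map \<tau> evaluates the image of a chosen
  polynomial representing \<open>u\<close>; the choice is harmless because two representatives
  differ by a multiple of \<open>F\<close>.\<close>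

lemma hom_extend:
  assumes "subset_hom M \<sigma>" and \<theta>': "\<theta>' ^ l = \<sigma> (\<theta> ^ l)"
  shows "\<exists>\<tau>. subset_hom E \<tau> \<and> (\<forall>a\<in>M. \<tau> a = \<sigma> a) \<and> \<tau> \<theta> = \<theta>'"
proof -
  interpret \<sigma>: subset_hom M \<sigma> by (rule assms(1))
  define \<tau> where "\<tau> u = poly (map_poly \<sigma> (SOME p. p \<in> polys M \<and> u = poly p \<theta>)) \<theta>'" for u
  have zero: "poly (map_poly \<sigma> p) \<theta>' = 0" if p: "p \<in> polys M" "poly p \<theta> = 0" for p
  proof -
    obtain q where q: "q \<in> polys M" "p = F * q" using F_dvd[OF p] by blast
    have "map_poly \<sigma> F = Polynomial.monom 1 l - [:\<theta>' ^ l:]"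
      unfolding F_def using \<theta>' l_gt_1
      by (intro poly_eqI)
        (auto simp: \<sigma>.coeff_map_hom coeff_pCons \<sigma>.hom_diff \<sigma>.hom_one \<sigma>.hom_zero \<sigma>.hom_uminus \<theta> split: nat.split)
    then show ?thesis
      using q by (simp add: \<sigma>.map_poly_hom_mult F_poly poly_monom)
  qed
  have \<tau>: "\<tau> (poly p \<theta>) = poly (map_poly \<sigma> p) \<theta>'" if p: "p \<in> polys M" for p
  proof -
    define q where "q = (SOME q. q \<in> polys M \<and> poly p \<theta> = poly q \<theta>)"
    have q: "q \<in> polys M \<and> poly p \<theta> = poly q \<theta>"
      unfolding q_def by (rule someI[of _ p]) (use p in auto)
    have "poly (map_poly \<sigma> (q - p)) \<theta>' = 0"
      using p q by (intro zero polys_closed) auto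
    moreover have "\<tau> (poly p \<theta>) = poly (map_poly \<sigma> q) \<theta>'"
      unfolding \<tau>_def q_def ..
    ultimately show ?thesis
      using p q by (simp add: \<sigma>.map_poly_hom_diff)
  qed
  have const: "\<tau> a = \<sigma> a" if "a \<in> M" for a
    using \<tau>[OF const_polys[OF that]] by (simp add: \<sigma>.map_poly_hom_pCons)
  have "subset_hom E \<tau>"
  proof unfold_locales
    fix u v assume "u \<in> E" "v \<in> E"
    then obtain p q where pq: "p \<in> polys M" "q \<in> polys M" "u = poly p \<theta>" "v = poly q \<theta>"
      using E_eq_poly by metis
    then show "\<tau> (u + v) = \<tau> u + \<tau> v" "\<tau> (u * v) = \<tau> u * \<tau> v"
      using \<tau>[of "p + q"] \<tau>[of "p * q"] \<tau>[of p] \<tau>[of q]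
      by (auto simp: polys_closed \<sigma>.map_poly_hom_add \<sigma>.map_poly_hom_mult)
  next
    show "\<tau> 1 = 1" using const[OF one_closed] \<sigma>.hom_one by simp
  qed
  moreover have "\<tau> \<theta> = \<theta>'"
    using \<tau>[of "[:0, 1:]"]
    by (simp add: \<sigma>.map_poly_hom_pCons \<sigma>.hom_zero \<sigma>.hom_one pCons_polys const_polys closed)
  ultimately show ?thesis using const by blast
qed

lemma hom_eq_on_E:
  assumes "subset_hom E \<sigma>" "subset_hom E \<tau>" "\<And>a. a \<in> M \<Longrightarrow> \<sigma> a = \<tau> a" "\<sigma> \<theta> = \<tau> \<theta>" "u \<in> E"
  shows "\<sigma> u = \<tau> u"
proof -
  interpret \<sigma>: subset_hom E \<sigma> by (rule assms)
  interpret \<tau>: subset_hom E \<tau> by (rule assms)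
  obtain p where p: "p \<in> polys M" "u = poly p \<theta>" using E_eq_poly assms by blast
  have pE: "p \<in> polys E" using p M_subset_E by (auto simp: polys_iff)
  have "map_poly \<sigma> p = map_poly \<tau> p"
    using p assms(3) by (intro poly_eqI) (auto simp: \<sigma>.coeff_map_hom \<tau>.coeff_map_hom polys_iff)
  then show ?thesis
    using \<sigma>.poly_map_hom[OF pE theta_mem_E] \<tau>.poly_map_hom[OF pE theta_mem_E] p assms by simp
qed

lemma hom_mem:
  assumes "subset_hom E \<sigma>" "unital_subring N" "\<And>a. a \<in> M \<Longrightarrow> \<sigma> a \<in> N" "\<sigma> \<theta> \<in> N" "u \<in> E"
  shows "\<sigma> u \<in> N"
proof -
  interpret \<sigma>: subset_hom E \<sigma> by (rule assms)
  interpret N: unital_subring N by (rule assms)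
  obtain p where p: "p \<in> polys M" "u = poly p \<theta>" using E_eq_poly assms by blast
  have pE: "p \<in> polys E" using p M_subset_E by (auto simp: polys_iff)
  have "map_poly \<sigma> p \<in> polys N"
    using p assms(3) by (auto simp: \<sigma>.coeff_map_hom polys_iff)
  then show ?thesis
    using \<sigma>.poly_map_hom[OF pE theta_mem_E] p assms N.poly_closed by metis
qed

text \<open>\<tau> is M-linear and diagonal in the basis of powers of \<theta>, with the distinct
  eigenvalues \<open>\<zeta>^i\<close>, so each eigenspace is a line. The case \<open>j = 0\<close>
  gives the fixed field.\<close>

lemma eigenvector:
  assumes "subset_hom E \<tau>" "\<And>a. a \<in> M \<Longrightarrow> \<tau> a = a" "\<tau> \<theta> = \<zeta> * \<theta>"
    and "u \<in> E" "\<tau> u = \<zeta> ^ j * u" "j < l"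
  shows "\<exists>b\<in>M. u = b * \<theta> ^ j"
proof -
  interpret \<tau>: subset_hom E \<tau> by (rule assms)
  obtain p where p: "p \<in> polys M" "\<And>i. i \<ge> l \<Longrightarrow> Polynomial.coeff p i = 0" "u = poly p \<theta>"
    using E_rep[OF assms(4)] by blast
  have u: "u = (\<Sum>i<l. Polynomial.coeff p i * \<theta> ^ i)"
    unfolding p(3) poly_altdef
    by (rule sum.mono_neutral_cong) (use p(2) in \<open>auto simp: coeff_eq_0 intro: ccontr\<close>)
  have cM: "Polynomial.coeff p i \<in> M" for i using p(1) by (simp add: polys_iff)
  have "\<tau> u = (\<Sum>i<l. Polynomial.coeff p i * (\<zeta> * \<theta>) ^ i)"
  proof -
    have mem: "Polynomial.coeff p i \<in> E" "\<theta> ^ i \<in> E" for i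
      using cM M_subset_E theta_mem_E by (auto intro: E.closed)
    show ?thesis unfolding u using cM assms(2,3) theta_mem_E mem
      by (subst \<tau>.hom_sum) (auto simp: \<tau>.hom_mult \<tau>.hom_power intro: E.mult_closed)
  qed
  \<comment> \<open>The expansion of \<open>\<tau> u - \<zeta>^j u\<close>. It vanishes at \<theta>,
    so independence kills every coefficient of \<open>p\<close> except the one at
    \<open>j\<close>.\<close>
  define q where "q = (\<Sum>i<l. Polynomial.monom ((\<zeta> ^ i - \<zeta> ^ j) * Polynomial.coeff p i) i)"
  have coeff_q: "Polynomial.coeff q i = (if i < l then (\<zeta> ^ i - \<zeta> ^ j) * Polynomial.coeff p i else 0)" for i
    by (simp add: q_def Polynomial.coeff_sum if_distrib)
  have "poly q \<theta> = \<tau> u - \<zeta> ^ j * u"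
    unfolding \<open>\<tau> u = (\<Sum>i<l. _ i)\<close> unfolding u
    by (simp add: q_def poly_sum poly_monom sum_distrib_left power_mult_distrib algebra_simps sum_subtractf)
  then have "poly q \<theta> = 0" using assms by simp
  moreover have "q \<in> polys M"
    using cM \<zeta> by (auto simp: polys_iff coeff_q intro!: closed)
  ultimately have "q = 0" by (intro independent) (auto simp: coeff_q)
  have zeta_inj: "\<zeta> ^ i \<noteq> \<zeta> ^ k" if "i < k" "k < l" for i k
  proof
    assume "\<zeta> ^ i = \<zeta> ^ k"
    moreover have "\<zeta> ^ k = \<zeta> ^ i * \<zeta> ^ (k - i)" using that by (simp flip: power_add)
    moreover have "\<zeta> ^ i \<noteq> 0" using \<zeta>(2) l_gt_1 by (cases "\<zeta> = 0") (auto simp: power_0_left)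
    ultimately show False using \<zeta>(3)[of "k - i"] that by simp
  qed
  have "Polynomial.coeff p i = 0" if "i < l" "i \<noteq> j" for i
  proof -
    have "(\<zeta> ^ i - \<zeta> ^ j) * Polynomial.coeff p i = 0"
      using coeff_q[of i] that \<open>q = 0\<close> by simp
    then show ?thesis using zeta_inj[of i j] zeta_inj[of j i] that assms(6) by (cases "i < j") auto
  qed
  then have "u = (\<Sum>i<l. if i = j then Polynomial.coeff p i * \<theta> ^ i else 0)"
    unfolding u by (intro sum.cong) auto
  then show ?thesis using cM assms(6) by (intro bexI[of _ "Polynomial.coeff p j"]) auto
qed

lemma fixed_mem:
  assumes "subset_hom E \<tau>" "\<And>a. a \<in> M \<Longrightarrow> \<tau> a = a" "\<tau> \<theta> = \<zeta> * \<theta>" "u \<in> E" "\<tau> u = u"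
  shows "u \<in> M"
  using eigenvector[OF assms(1-4), of 0] assms(5) l_gt_1 by auto

end


section \<open>Valuations on Kummer extensions\<close>

text \<open>Taylor expansion to first order with the remainder kept in the ring; in a valuation ring
  it shows that the error of a Newton step is quadratic.\<close>

lemma (in unital_subring) power_add_expand:
  assumes "a \<in> A" "d \<in> A"
  shows "\<exists>r\<in>A. (a + d) ^ n = a ^ n + of_nat n * a ^ (n - 1) * d + d\<^sup>2 * r"
proof (induction n)
  case 0
  show ?case by (rule bexI[of _ 0]) (auto intro: closed)
next
  case (Suc n)
  then obtain r where r: "r \<in> A" "(a + d) ^ n = a ^ n + of_nat n * a ^ (n - 1) * d + d\<^sup>2 * r" by blast
  show ?case
  proof (rule bexI)
    have "of_nat n * a ^ (n - 1) * a = of_nat n * a ^ n"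
      by (cases n) auto
    moreover have "a * (of_nat n * a ^ (n - 1) * d) = (of_nat n * a ^ (n - 1) * a) * d"
      by (simp only: ac_simps)
    ultimately have *: "a * (of_nat n * a ^ (n - 1) * d) = of_nat n * a ^ n * d"
      by simp
    have "(a + d) ^ Suc n = a * a ^ n + a * (of_nat n * a ^ (n - 1) * d) + d * a ^ n
        + d\<^sup>2 * (of_nat n * a ^ (n - 1) + a * r + d * r)"
      by (simp add: r(2) algebra_simps power2_eq_square)
    then show "(a + d) ^ Suc n = a ^ Suc n + of_nat (Suc n) * a ^ (Suc n - 1) * d
        + d\<^sup>2 * (of_nat n * a ^ (n - 1) + a * r + d * r)"
      unfolding * by (simp add: algebra_simps)
    show "of_nat n * a ^ (n - 1) + a * r + d * r \<in> A"
      by (intro closed assms r)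
  qed
qed

locale valuation_on = L: field_subset L for L :: "'a::field set" +
  fixes w :: "'a \<Rightarrow> int"
  assumes val_mult: "a \<in> L \<Longrightarrow> b \<in> L \<Longrightarrow> a \<noteq> 0 \<Longrightarrow> b \<noteq> 0 \<Longrightarrow> w (a * b) = w a + w b"
    and val_add: "a \<in> L \<Longrightarrow> b \<in> L \<Longrightarrow> a \<noteq> 0 \<Longrightarrow> b \<noteq> 0 \<Longrightarrow> a + b \<noteq> 0 \<Longrightarrow>
      min (w a) (w b) \<le> w (a + b)"
begin

definition val_ring :: "'a set" where
  "val_ring = {a \<in> L. a = 0 \<or> w a \<ge> 0}"

definition max_ideal :: "'a set" where
  "max_ideal = {a \<in> L. a = 0 \<or> w a > 0}"

lemma val_one: "w 1 = 0"
  using val_mult[of 1 1] L.one_closed by simp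

lemma val_minus_one: "w (- 1) = 0"
  using val_mult[of "-1" "-1"] L.one_closed L.uminus_closed val_one by simp

lemma val_uminus: "a \<in> L \<Longrightarrow> a \<noteq> 0 \<Longrightarrow> w (- a) = w a"
  using val_mult[of "-1" a] L.one_closed L.uminus_closed val_minus_one by simp

lemma val_inverse: "a \<in> L \<Longrightarrow> a \<noteq> 0 \<Longrightarrow> w (inverse a) = - w a"
  using val_mult[of a "inverse a"] L.inverse_closed val_one by simp

lemma val_divide: "a \<in> L \<Longrightarrow> b \<in> L \<Longrightarrow> a \<noteq> 0 \<Longrightarrow> b \<noteq> 0 \<Longrightarrow> w (a / b) = w a - w b"
  by (simp add: divide_inverse val_mult val_inverse L.inverse_closed)

lemma val_power: "a \<in> L \<Longrightarrow> a \<noteq> 0 \<Longrightarrow> w (a ^ n) = int n * w a"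
  by (induction n) (auto simp: val_one val_mult L.power_closed algebra_simps)

lemma val_prod:
  "(\<And>i. i \<in> I \<Longrightarrow> f i \<in> L) \<Longrightarrow> (\<And>i. i \<in> I \<Longrightarrow> f i \<noteq> 0) \<Longrightarrow> w (prod f I) = (\<Sum>i\<in>I. w (f i))"
  by (induction I rule: infinite_finite_induct) (auto simp: val_one val_mult L.prod_closed)

text \<open>The summand of smaller value dominates, as \<open>a\<close> is recovered by subtracting
  \<open>b\<close> from \<open>a + b\<close>. The alternative \<open>b = 0\<close> is listed since
  \<open>w 0\<close> carries no information.\<close>

lemma val_add_eq:
  assumes "a \<in> L" "b \<in> L" "a \<noteq> 0" "b = 0 \<or> w a < w b"
  shows "a + b \<noteq> 0" "w (a + b) = w a"
proof -
  show nz: "a + b \<noteq> 0"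
  proof
    assume "a + b = 0"
    then have "b = - a" by (simp add: eq_neg_iff_add_eq_0 add.commute)
    with assms val_uminus[of a] show False by auto
  qed
  show "w (a + b) = w a"
  proof (cases "b = 0")
    case False
    have "min (w (a + b)) (w (- b)) \<le> w (a + b + - b)"
      using assms False nz by (intro val_add L.closed) auto
    then show ?thesis
      using assms False nz val_uminus[of b] val_add[of a b] by auto
  qed simp
qed

text \<open>The valuation ring of a subfield \<open>M\<close> is \<open>val_ring \<inter> M\<close>,
  and its elements of value 0 are units inside \<open>M\<close>. Arguing modulo
  \<open>max_ideal\<close> thus amounts to comparing the residue field of \<open>M\<close> with that
  of \<open>L\<close>.\<close>

lemma local_pair:
  assumes "field_subset M" "M \<subseteq> L"
  shows "local_pair val_ring (val_ring \<inter> M) max_ideal"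
proof -
  interpret M: field_subset M by (rule assms)
  have add: "a + b \<in> val_ring" if "a \<in> val_ring" "b \<in> val_ring" for a b
    using that val_add[of a b]
    by (cases "a = 0"; cases "b = 0"; cases "a + b = 0") (auto simp: val_ring_def L.closed)
  have mult: "a * b \<in> val_ring" if "a \<in> val_ring" "b \<in> val_ring" for a b
    using that val_mult[of a b]
    by (cases "a = 0"; cases "b = 0") (auto simp: val_ring_def L.closed)
  have uminus: "- a \<in> val_ring" if "a \<in> val_ring" for a
    using that val_uminus[of a] by (cases "a = 0") (auto simp: val_ring_def L.closed)
  have zero_one: "0 \<in> val_ring" "1 \<in> val_ring"
    by (auto simp: val_ring_def val_one L.closed)
  show ?thesis
  proof unfold_locales
    fix a b
    show "a + b \<in> max_ideal" if "a \<in> max_ideal" "b \<in> max_ideal"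
      using that val_add[of a b]
      by (cases "a = 0"; cases "b = 0"; cases "a + b = 0") (auto simp: max_ideal_def L.closed)
    show "a * b \<in> max_ideal" if "a \<in> val_ring" "b \<in> max_ideal"
      using that val_mult[of a b]
      by (cases "a = 0"; cases "b = 0") (auto simp: max_ideal_def val_ring_def L.closed)
    show "a \<in> max_ideal \<or> b \<in> max_ideal" if "a \<in> val_ring" "b \<in> val_ring" "a * b \<in> max_ideal"
      using that val_mult[of a b]
      by (cases "a = 0"; cases "b = 0") (auto simp: max_ideal_def val_ring_def L.closed)
    show "inverse a \<in> val_ring \<inter> M" if "a \<in> val_ring \<inter> M" "a \<notin> max_ideal"
      using that val_inverse[of a]
      by (auto simp: max_ideal_def val_ring_def L.field_closed M.inverse_closed)
  qed (use assms zero_one in \<open>auto simp: max_ideal_def val_one L.closed M.closed add mult uminus,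
      auto simp: val_ring_def\<close>)
qed

text \<open>Division by a coefficient of least value makes that coefficient 1 and all others
  integral, so the result is nonzero over the residue field.\<close>

lemma normalise_poly:
  assumes "field_subset M" "M \<subseteq> L" "p \<in> polys M" "p \<noteq> 0"
  shows "\<exists>c\<in>M. \<exists>q\<in>polys (val_ring \<inter> M). c \<noteq> 0 \<and> p = Polynomial.smult c q \<and> q \<notin> polys max_ideal"
proof -
  interpret M: field_subset M by (rule assms)
  define I where "I = {i. Polynomial.coeff p i \<noteq> 0}"
  have I: "finite I" unfolding I_def
    by (rule finite_subset[of _ "{..Polynomial.degree p}"]) (auto intro: le_degree)
  have "I \<noteq> {}" using assms(4) unfolding I_def by (metis (mono_tags) leading_coeff_0_iff empty_iff mem_Collect_eq)
  define W where "W = (\<lambda>i. w (Polynomial.coeff p i)) ` I"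
  have "Min W \<in> W" using I \<open>I \<noteq> {}\<close> by (simp add: W_def)
  then obtain i where i: "i \<in> I" "w (Polynomial.coeff p i) = Min W" by (auto simp: W_def)
  have le: "w (Polynomial.coeff p i) \<le> w (Polynomial.coeff p j)" if "j \<in> I" for j
    using that I i(2) by (simp add: W_def)
  define c where "c = Polynomial.coeff p i"
  have cM: "Polynomial.coeff p j \<in> M" for j using assms(3) by (simp add: polys_iff)
  have c: "c \<noteq> 0" "c \<in> M" using i cM by (auto simp: I_def c_def)
  have cL: "c \<in> L" using c assms(2) by blast
  define q where "q = Polynomial.smult (inverse c) p"
  have "Polynomial.coeff q j \<in> val_ring \<inter> M" for j
  proof (cases "j \<in> I")
    case False
    then show ?thesis by (simp add: q_def I_def val_ring_def L.closed M.closed)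
  next
    case True
    then have "w (inverse c * Polynomial.coeff p j) \<ge> 0"
      using le[OF True] c cM assms(2) True val_inverse[OF cL c(1)]
      by (subst val_mult[OF L.inverse_closed[OF cL]]) (auto simp: I_def c_def)
    then show ?thesis
      using c cM assms(2) by (auto simp: q_def val_ring_def intro!: L.mult_closed L.inverse_closed M.mult_closed M.inverse_closed)
  qed
  then have "q \<in> polys (val_ring \<inter> M)" by (simp add: polys_iff)
  moreover have "Polynomial.coeff q i = 1" using c by (simp add: q_def c_def)
  then have "q \<notin> polys max_ideal" by (auto simp: polys_iff max_ideal_def val_one intro!: exI[of _ i])
  moreover have "p = Polynomial.smult c q" using c by (simp add: q_def)
  ultimately show ?thesis using c by blast
qed

text \<open>If the residue of \<open>\<theta>\<close> is not in the residue field of \<open>M\<close>, then \<open>X ^ l - \<theta> ^ l\<close> stays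
  irreducible over the residue field; otherwise Newton's method approximates \<open>\<theta>\<close> within \<open>M\<close>.\<close>

lemma value_group_kummer_step:
  assumes "kummer_step M l \<zeta> \<theta>" and E_L: "kummer_step.E M \<theta> \<subseteq> L"
    and w\<theta>: "w \<theta> = 0" and wl: "(of_nat l :: 'a) \<noteq> 0" "w (of_nat l) = 0"
    and w\<zeta>: "\<And>i. 0 < i \<Longrightarrow> i < l \<Longrightarrow> w (\<zeta> ^ i - 1) = 0"
    and u: "u \<in> kummer_step.E M \<theta>" "u \<noteq> 0"
  shows "\<exists>b\<in>M. b \<noteq> 0 \<and> w u = w b"
proof -
  interpret kummer_step M l \<zeta> \<theta> by (rule assms)
  have M_L: "M \<subseteq> L" using M_subset_E E_L by blast
  interpret V: local_pair val_ring "val_ring \<inter> M" max_ideal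
    by (rule local_pair[OF field_subset_axioms M_L])
  have \<theta>L: "\<theta> \<in> L" using theta_mem_E E_L by blast
  have \<theta>V: "\<theta> \<in> val_ring" "\<theta> \<notin> max_ideal"
    using w\<theta> \<theta>L theta_nonzero by (auto simp: val_ring_def max_ideal_def)
  have \<theta>lV: "\<theta> ^ l \<in> val_ring \<inter> M" using \<theta>V \<theta>(1) by (auto intro: V.V.power_closed)
  obtain p where p: "p \<in> polys M" "\<And>i. i \<ge> l \<Longrightarrow> Polynomial.coeff p i = 0" "u = poly p \<theta>"
    using E_rep[OF u(1)] by blast
  have "p \<noteq> 0" using u p by auto
  from normalise_poly[OF field_subset_axioms M_L p(1) this] obtain c q where
    c: "c \<in> M" "c \<noteq> 0" and q: "q \<in> polys (val_ring \<inter> M)" "p = Polynomial.smult c q" "q \<notin> polys max_ideal"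
    by blast
  have qV: "q \<in> polys val_ring" using q(1) by (simp add: polys_iff)
  have uq: "u = c * poly q \<theta>" using p q by simp
  have q\<theta>: "poly q \<theta> \<noteq> 0" "poly q \<theta> \<in> val_ring"
    using uq u V.V.poly_closed[OF qV \<theta>V(1)] by auto
  then have wu: "w u = w c + w (poly q \<theta>)"
    unfolding uq using c M_L by (intro val_mult) (auto simp: val_ring_def)
  show ?thesis
  proof (cases "\<exists>b\<in>val_ring \<inter> M. \<theta> - b \<in> max_ideal")
    case False
    \<comment> \<open>Here the powers of \<theta> below the l-th remain independent over the residue
      field, and \<open>q\<close> is nonzero there. So \<open>poly q \<theta>\<close> is a unit and
      the value of \<open>u\<close> is that of \<open>c\<close>.\<close>
    have "poly q \<theta> \<notin> max_ideal"
    proof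
      assume *: "poly q \<theta> \<in> max_ideal"
      have "q \<in> polys max_ideal"
      proof (rule V.kummer_independent[OF l \<theta>V \<theta>lV _ \<zeta>(2) _ _ q(1) _ *])
        have "\<zeta> \<noteq> 0" using \<zeta>(2) l_gt_1 by (auto simp: power_0_left)
        moreover from this have "w \<zeta> = 0"
          using val_power[of \<zeta> l] \<zeta> M_L l_gt_1 val_one by auto
        ultimately show "\<zeta> \<in> val_ring \<inter> M" using \<zeta> M_L by (auto simp: val_ring_def)
        show "\<zeta> ^ i - 1 \<notin> max_ideal" if "0 < i" "i < l" for i
          using w\<zeta>[OF that] \<zeta>(3)[OF that] by (simp add: max_ideal_def)
        show "Polynomial.coeff q i = 0" if "i \<ge> l" for i
          using p(2)[OF that] q(2) c by simp
      qed (use False in auto)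
      with q(3) show False by blast
    qed
    then have "w (poly q \<theta>) = 0" using q\<theta> by (auto simp: val_ring_def max_ideal_def)
    then show ?thesis using wu c by auto
  next
    case True
    \<comment> \<open>No \<open>b\<close> in \<open>M\<close> equals \<theta>, so
      \<open>\<theta> - b\<close> is nonzero and its value is meaningful at every stage.\<close>
    define approx where "approx n b \<longleftrightarrow> b \<in> M \<and> b \<in> val_ring \<and> w (\<theta> - b) > n" for n b
    have ne: "\<theta> - b \<noteq> 0" if "b \<in> M" for b using that \<theta>(2) by auto
    have improve: "\<exists>b'. approx (int (Suc n)) b'" if ap: "approx (int n) b" for n b
    proof -
      have b: "b \<in> M" "b \<in> val_ring" "w (\<theta> - b) > int n" using ap by (auto simp: approx_def)
      have bL: "b \<in> L" using b M_L by blast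
      define \<delta> where "\<delta> = \<theta> - b"
      have \<delta>L: "\<delta> \<in> L" "\<delta> \<noteq> 0" unfolding \<delta>_def using \<theta>L bL ne[OF b(1)] by (auto intro: L.closed)
      have \<delta>V: "\<delta> \<in> val_ring" "\<delta> \<in> max_ideal"
        using \<delta>L b(3) by (auto simp: val_ring_def max_ideal_def \<delta>_def)
      have "b \<notin> max_ideal" using V.m_diff_iff[of \<theta> b] \<delta>V(2) \<theta>V(2) by (simp add: \<delta>_def)
      then have wb: "w b = 0" "b \<noteq> 0" using b(2) by (auto simp: val_ring_def max_ideal_def)
      obtain r where r: "r \<in> val_ring"
        "(b + \<delta>) ^ l = b ^ l + of_nat l * b ^ (l - 1) * \<delta> + \<delta>\<^sup>2 * r"
        using V.V.power_add_expand[OF b(2) \<delta>V(1)] by blast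
      define D where "D = of_nat l * b ^ (l - 1)"
      have D: "D \<noteq> 0" "D \<in> M" "w D = 0"
      proof -
        show "D \<noteq> 0" "D \<in> M" unfolding D_def using wl wb b by (auto intro!: closed)
        show "w D = 0" unfolding D_def using wl wb bL
          by (subst val_mult) (auto simp: val_power intro!: L.closed)
      qed
      \<comment> \<open>The Newton step for \<open>X^l - \<theta>^l\<close> at \<open>b\<close>. It
        stays in \<open>M\<close> because only \<open>\<theta>^l\<close> enters, and
        \<open>D\<close>, the derivative at \<open>b\<close>, is a unit because \<open>l\<close> and
        \<open>b\<close> have value 0. The new error is the square of the old one times an integral
        factor.\<close>
      define b' where "b' = b + (\<theta> ^ l - b ^ l) / D"
      have b'M: "b' \<in> M" unfolding b'_def 
      by (intro add_closed divide_closed diff_closed power_closed[of b] b D \<theta>)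
      have "\<theta> ^ l - b ^ l = D * \<delta> + \<delta>\<^sup>2 * r"
        using r(2) by (simp add: \<delta>_def D_def)
      then have eq: "\<theta> - b' = - (\<delta>\<^sup>2 * r / D)"
        using D by (simp add: b'_def \<delta>_def field_simps)
      have "r \<noteq> 0" using eq ne[OF b'M] by auto
      then have rL: "r \<in> L" "w r \<ge> 0" using r by (auto simp: val_ring_def)
      have DL: "D \<in> L" using D M_L by blast
      have "w (\<theta> - b') = 2 * w \<delta> + w r - w D"
        unfolding eq using \<delta>L rL DL D \<open>r \<noteq> 0\<close>
        by (subst val_uminus) (auto simp: val_divide val_mult val_power L.closed L.divide_closed)
      also have "\<dots> > int (Suc n)"
        using rL D b(3) by (simp add: \<delta>_def)
      finally have gt: "w (\<theta> - b') > int (Suc n)" .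
      have "\<theta> - b' \<in> val_ring"
        using gt b'M M_L \<theta>L by (auto simp: val_ring_def intro!: L.closed)
      then have "\<theta> - (\<theta> - b') \<in> val_ring" by (rule V.V.diff_closed[OF \<theta>V(1)])
      then show ?thesis using gt b'M by (auto simp: approx_def)
    qed
    have ex: "\<exists>b. approx (int n) b" for n
    proof (induction n)
      case 0
      from True obtain b where "b \<in> val_ring \<inter> M" "\<theta> - b \<in> max_ideal" by blast
      then show ?case using ne by (auto simp: approx_def max_ideal_def intro!: exI[of _ b])
    next
      case (Suc n)
      then show ?case using improve by blast
    qed
    \<comment> \<open>Precision beyond the value of \<open>poly q \<theta>\<close> is enough:
      \<open>poly q \<theta> - poly q b\<close> is an integral multiple of
      \<open>\<theta> - b\<close>, so it is zero or of larger value, and \<open>poly q b\<close> has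
      the value of \<open>poly q \<theta>\<close>.\<close>
    obtain b where b: "b \<in> M" "b \<in> val_ring" "w (\<theta> - b) > int (nat (w (poly q \<theta>)))"
      using ex unfolding approx_def by blast
    then have b3: "w (poly q \<theta>) < w (\<theta> - b)" by linarith
    define g where "g = poly (synthetic_div q b) \<theta>"
    have gV: "g \<in> val_ring" unfolding g_def
      by (intro V.V.poly_closed V.V.synthetic_div_polys qV b \<theta>V)
    have eq: "poly q \<theta> = (\<theta> - b) * g + poly q b"
      using arg_cong[OF synthetic_div_correct'[of b q], of "\<lambda>p. poly p \<theta>"]
      by (simp add: g_def algebra_simps)
    have bL: "\<theta> - b \<in> L" using b M_L \<theta>L by (auto intro: L.closed)
    define e where "e = - ((\<theta> - b) * g)"
    have gL: "(\<theta> - b) * g \<in> L" using gV bL by (auto simp: val_ring_def intro: L.closed)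
    have eL: "e \<in> L" unfolding e_def using gL by (rule L.uminus_closed)
    have "w (poly q \<theta>) < w e" if "e \<noteq> 0"
    proof -
      have "g \<noteq> 0" using that by (auto simp: e_def)
      then have "w e = w (\<theta> - b) + w g" "w g \<ge> 0"
        using gV gL bL ne[OF b(1)] that by (auto simp: e_def val_uminus val_mult val_ring_def)
      then show ?thesis using b3 by simp
    qed
    then have "poly q \<theta> + e \<noteq> 0" "w (poly q \<theta> + e) = w (poly q \<theta>)"
      using val_add_eq[OF _ eL q\<theta>(1)] q\<theta>(2) by (auto simp: val_ring_def)
    moreover have "poly q \<theta> + e = poly q b" using eq by (simp add: e_def)
    ultimately have qb: "poly q b \<noteq> 0" "w (poly q b) = w (poly q \<theta>)" by auto
    have "q \<in> polys M" using q(1) by (simp add: polys_iff)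
    then have qbM: "poly q b \<in> M" using b by (intro poly_closed)
    have "w (c * poly q b) = w u"
      unfolding wu using c qb qbM M_L by (subst val_mult) auto
    then show ?thesis using c qb qbM by (intro bexI[of _ "c * poly q b"]) (auto intro: closed)
  qed
qed

end


section \<open>The tower of Kummer extensions\<close>

lemma prod_lessThan_add:
  fixes f :: "nat \<Rightarrow> 'a::comm_monoid_mult"
  shows "(\<Prod>i<n + k. f i) = (\<Prod>i<n. f i) * (\<Prod>i<k. f (n + i))"
  by (induction k) (auto simp: ac_simps)

lemma primitive_root_power_inj:
  fixes \<zeta> :: "'a::field"
  assumes "\<zeta> ^ l = 1" "\<And>i. 0 < i \<Longrightarrow> i < l \<Longrightarrow> \<zeta> ^ i \<noteq> 1" "i < l" "j < l" "\<zeta> ^ i = \<zeta> ^ j"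
  shows "i = j"
proof -
  have \<zeta>0: "\<zeta> \<noteq> 0" using assms(1,3) by (auto simp: power_0_left)
  have "\<not> (i < j)" if "i < l" "j < l" "\<zeta> ^ i = \<zeta> ^ j" for i j
  proof
    assume "i < j"
    then have "\<zeta> ^ j = \<zeta> ^ i * \<zeta> ^ (j - i)" by (simp flip: power_add)
    with that \<zeta>0 assms(2)[of "j - i"] \<open>i < j\<close> show False by simp
  qed
  from this[of i j] this[of j i] assms show ?thesis by auto
qed

text \<open>As polynomials in \<open>u\<close>, both sides are monic of degree \<open>l\<close> with
  the same \<open>l\<close> roots \<open>\<zeta>^i v\<close>. For \<open>v = 0\<close> these roots
  coincide, so that case is separate.\<close>

lemma prod_minus_roots_of_unity:
  fixes \<zeta> u v :: "'a::field"
  assumes "l > 0" "\<zeta> ^ l = 1" "\<And>i. 0 < i \<Longrightarrow> i < l \<Longrightarrow> \<zeta> ^ i \<noteq> 1"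
  shows "(\<Prod>i<l. u - \<zeta> ^ i * v) = u ^ l - v ^ l"
proof (cases "v = 0")
  case True
  then show ?thesis using assms(1) by simp
next
  case False
  interpret local_pair UNIV UNIV "{0 :: 'a}"
    by unfold_locales auto
  define T where "T = (\<lambda>i. \<zeta> ^ i * v) ` {..<l}"
  have inj: "inj_on (\<lambda>i. \<zeta> ^ i * v) {..<l}"
    using primitive_root_power_inj[OF assms(2,3)] False by (auto intro!: inj_onI)
  define f where "f = (\<Prod>i<l. [:- (\<zeta> ^ i * v), 1:]) - (Polynomial.monom 1 l - [:v ^ l:])"
  have deg: "Polynomial.degree (\<Prod>i<l. [:- (\<zeta> ^ i * v), 1:]) = l"
    by (subst degree_prod_eq_sum_degree) auto
  have "Polynomial.lead_coeff (\<Prod>i<l. [:- (\<zeta> ^ i * v), 1:]) = 1"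
    by (simp add: lead_coeff_prod)
  then have "Polynomial.coeff (\<Prod>i<l. [:- (\<zeta> ^ i * v), 1:]) i = (if i = l then 1 else 0)" if "i \<ge> l" for i
    using that deg by (auto simp: coeff_eq_0)
  then have coeff: "Polynomial.coeff f i = 0" if "i \<ge> l" for i
    using that assms(1) by (auto simp: f_def coeff_pCons split: nat.split)
  have "f \<in> polys {0}"
  proof (rule coeffs_mem_m_if_roots[of T])
    show "poly f t \<in> {0}" if t: "t \<in> T" for t
    proof -
      obtain i where i: "i < l" "t = \<zeta> ^ i * v" using t by (auto simp: T_def)
      have "(\<zeta> ^ i) ^ l = 1" using assms(2) by (metis mult.commute power_mult power_one)
      then have "t ^ l = v ^ l" by (simp add: i power_mult_distrib)
      moreover have "(\<Prod>i<l. t - \<zeta> ^ i * v) = 0" using i by auto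
      ultimately show ?thesis by (simp add: f_def poly_prod poly_monom)
    qed
  qed (auto simp: T_def card_image[OF inj] coeff polys_iff)
  then have "f = 0" by (intro poly_eqI) (auto simp: polys_iff)
  then have "poly f u = 0" by simp
  then show ?thesis by (simp add: f_def poly_prod poly_monom)
qed

lemma powers_eq_imp_root_of_unity_multiple:
  fixes \<zeta> a b :: "'a::field"
  assumes "l > 0" "\<zeta> ^ l = 1" "\<And>i. 0 < i \<Longrightarrow> i < l \<Longrightarrow> \<zeta> ^ i \<noteq> 1" "a ^ l = b ^ l"
  shows "\<exists>i<l. a = \<zeta> ^ i * b"
proof -
  have "(\<Prod>i<l. a - \<zeta> ^ i * b) = 0"
    using prod_minus_roots_of_unity[OF assms(1-3), of a b] assms(4) by simp
  then show ?thesis by auto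
qed

text \<open>An abstract form of the situation over \<open>k(t)\<close>, with \<open>x^l\<close> for
  \<open>t\<close> and \<open>C\<close> for \<open>c\<close>. By \<open>not_power\<close>,
  \<open>C^l - t\<close> is not an l-th power times a power of \<open>t\<close>, which is what
  Kummer theory asks for \<open>y\<close> to lie outside \<open>K(x)\<close>.\<close>

locale heisenberg_tower = K: field_subset K for K :: "'a::field set" +
  fixes l :: nat and \<zeta> C x y z :: 'a
  assumes l: "prime l"
    and \<zeta>: "\<zeta> \<in> K" "\<zeta> ^ l = 1" "\<And>i. 0 < i \<Longrightarrow> i < l \<Longrightarrow> \<zeta> ^ i \<noteq> 1"
    and C: "C \<in> K" and x: "x ^ l \<in> K" "x \<notin> K"
    and y: "y ^ l = C ^ l - x ^ l"
    and z: "z ^ l = (\<Prod>i = 1..l - 1. (C - \<zeta> ^ i * x) ^ i)"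
    and algebraic: "\<And>u. (ring.algebraic type_ring over K) u"
    and not_power: "\<And>b j. b \<in> K \<Longrightarrow> y ^ l \<noteq> b ^ l * (x ^ l) ^ j"
begin

lemma algebraic_over_superset: "K \<subseteq> M \<Longrightarrow> (ring.algebraic type_ring over M) u"
proof -
  interpret R: field "type_ring :: 'a ring" ..
  show "K \<subseteq> M \<Longrightarrow> (R.algebraic over M) u" using R.algebraic_mono algebraic by blast
qed

lemma l_gt_1: "l > 1" and l_pos: "l > 0"
  using prime_gt_1_nat[OF l] by auto

lemma zeta_nonzero: "\<zeta> \<noteq> 0"
  using \<zeta>(2) l_gt_1 by (auto simp: power_0_left)

lemma zeta_power_l: "(\<zeta> ^ i) ^ l = 1"
  using \<zeta>(2) by (metis mult.commute power_mult power_one)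

lemma y_nonzero: "y \<noteq> 0"
  using not_power[of 0 0] l_pos K.zero_closed by (auto simp: power_0_left)

lemmas root_of_unity_multiple = powers_eq_imp_root_of_unity_multiple[OF l_pos \<zeta>(2,3)]

sublocale S1: kummer_step K l \<zeta> x
  by unfold_locales (use l \<zeta> x algebraic in auto)

lemma S1_hom: "\<exists>\<sigma>. subset_hom S1.E \<sigma> \<and> (\<forall>a\<in>K. \<sigma> a = a) \<and> \<sigma> x = \<zeta> ^ i * x"
proof (rule S1.hom_extend)
  show "subset_hom K (\<lambda>a. a)" by unfold_locales auto
  show "(\<zeta> ^ i * x) ^ l = x ^ l" by (simp add: power_mult_distrib zeta_power_l)
qed

lemma y_power_mem: "y ^ l \<in> K"
  unfolding y using C x by (auto intro: K.closed)

text \<open>An automorphism of \<open>K(x)\<close> sending \<open>x\<close> to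
  \<open>\<zeta> x\<close> fixes \<open>y^l\<close>, so it would multiply \<open>y\<close> by some
  \<open>\<zeta>^j\<close>. Then \<open>y\<close> would be \<open>x^j\<close> times an element of
  \<open>K\<close>, against \<open>not_power\<close>.\<close>

lemma y_notin: "y \<notin> S1.E"
proof
  assume yE: "y \<in> S1.E"
  obtain \<sigma> where \<sigma>: "subset_hom S1.E \<sigma>" "\<forall>a\<in>K. \<sigma> a = a" "\<sigma> x = \<zeta> * x"
    using S1_hom[of 1] by auto
  interpret \<sigma>: subset_hom S1.E \<sigma> by (rule \<sigma>)
  have "\<sigma> y ^ l = y ^ l" using \<sigma>.hom_power[OF yE, of l] \<sigma>(2) y_power_mem by simp
  then obtain j where j: "j < l" "\<sigma> y = \<zeta> ^ j * y" using root_of_unity_multiple by blast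
  have "\<exists>b\<in>K. y = b * x ^ j"
    by (rule S1.eigenvector[OF \<sigma>(1) _ \<sigma>(3) yE j(2,1)]) (use \<sigma> in auto)
  then obtain b where b: "b \<in> K" "y = b * x ^ j" by blast
  then have "y ^ l = b ^ l * (x ^ l) ^ j"
    by (simp add: power_mult_distrib mult.commute flip: power_mult)
  with not_power b show False by blast
qed

sublocale S2: kummer_step S1.E l \<zeta> y
  by unfold_locales
    (use l \<zeta> y_notin y_power_mem S1.M_subset_E algebraic_over_superset[OF S1.M_subset_E] in auto)

section \<open>Behaviour of \<epsilon> when x is multiplied by roots of unity\<close>

definition eps :: "'a \<Rightarrow> 'a" where
  "eps v = (\<Prod>i = 1..l - 1. (C - \<zeta> ^ i * v) ^ i)"

text \<open>The factor \<open>(C - v)^l\<close> extends the product defining \<open>eps v\<close> to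
  \<open>i = l\<close>. After the shift of index, \<open>C - \<zeta>^i (\<zeta> v)\<close> occurs
  with exponent \<open>i + 1\<close>: the part with exponent \<open>i\<close> is
  \<open>eps (\<zeta> * v)\<close>, the remaining product of all factors is
  \<open>C^l - v^l = y^l\<close>.\<close>

lemma eps_shift:
  assumes "v ^ l = x ^ l"
  shows "eps (\<zeta> * v) * y ^ l = eps v * (C - v) ^ l"
proof -
  have "eps v * (C - v) ^ l = (\<Prod>i = 1..l. (C - \<zeta> ^ i * v) ^ i)"
  proof -
    have "{1..l} = insert l {1..l - 1}" using l_pos by auto
    moreover have "l \<notin> {1..l - 1}" using l_pos by auto
    ultimately show ?thesis using \<zeta>(2) by (simp add: eps_def)
  qed
  also have "\<dots> = (\<Prod>i<l. (C - \<zeta> ^ i * (\<zeta> * v)) ^ Suc i)"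
    by (simp add: prod.atLeast1_atMost_eq ac_simps)
  also have "\<dots> = (\<Prod>i<l. C - \<zeta> ^ i * (\<zeta> * v)) * (\<Prod>i<l. (C - \<zeta> ^ i * (\<zeta> * v)) ^ i)"
    by (simp add: prod.distrib)
  also have "(\<Prod>i<l. C - \<zeta> ^ i * (\<zeta> * v)) = y ^ l"
    using prod_minus_roots_of_unity[OF l_pos \<zeta>(2,3), of C "\<zeta> * v"] \<zeta>(2) assms
    by (simp add: power_mult_distrib y)
  also have "(\<Prod>i<l. (C - \<zeta> ^ i * (\<zeta> * v)) ^ i) = eps (\<zeta> * v)"
  proof -
    have "{..<l} = insert 0 {1..l - 1}" using l_pos by (cases l) (auto simp: less_Suc_eq_le)
    then show ?thesis by (simp add: eps_def)
  qed
  finally show ?thesis by (simp add: mult.commute)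
qed

text \<open>An explicit l-th root of \<open>eps (\<zeta>^n x) / eps x\<close>. An extension of
  \<open>x \<mapsto> \<zeta>^n x\<close> to the top field must send \<open>z\<close> to
  \<open>z * Q n\<close> up to an l-th root of unity.\<close>

definition Q :: "nat \<Rightarrow> 'a" where
  "Q n = (\<Prod>m<n. C - \<zeta> ^ m * x) / y ^ n"

lemma eps_shift_power: "eps (\<zeta> ^ n * x) = eps x * Q n ^ l"
proof (induction n)
  case (Suc n)
  have "eps (\<zeta> ^ Suc n * x) * y ^ l = eps x * Q n ^ l * (C - \<zeta> ^ n * x) ^ l"
    using eps_shift[of "\<zeta> ^ n * x"] Suc
    by (simp add: power_mult_distrib zeta_power_l mult.assoc)
  then have "eps (\<zeta> ^ Suc n * x) = eps x * Q n ^ l * (C - \<zeta> ^ n * x) ^ l / y ^ l"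
    using y_nonzero by (simp add: nonzero_eq_divide_eq)
  also have "\<dots> = eps x * (Q n * (C - \<zeta> ^ n * x) / y) ^ l"
    by (simp add: power_mult_distrib power_divide)
  also have "Q n * (C - \<zeta> ^ n * x) / y = Q (Suc n)"
    by (simp add: Q_def mult.commute)
  finally show ?case .
qed (simp add: Q_def)

text \<open>A full period multiplies the numerator by the product of all linear factors, which is
  \<open>y^l\<close>, and the denominator by \<open>y^l\<close>. So \<open>Q\<close> depends on the
  exponent modulo \<open>l\<close> only.\<close>

lemma Q_period: "Q (n + l) = Q n"
proof -
  have "(\<Prod>m<n + l. C - \<zeta> ^ m * x) = (\<Prod>m<n. C - \<zeta> ^ m * x) * (\<Prod>m<l. C - \<zeta> ^ m * (\<zeta> ^ n * x))"
    unfolding prod_lessThan_add[of _ n l] by (simp add: power_add ac_simps)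
  also have "(\<Prod>m<l. C - \<zeta> ^ m * (\<zeta> ^ n * x)) = y ^ l"
    using prod_minus_roots_of_unity[OF l_pos \<zeta>(2,3), of C "\<zeta> ^ n * x"]
    by (simp add: power_mult_distrib y zeta_power_l)
  finally show ?thesis using y_nonzero by (simp add: Q_def power_add)
qed

lemma Q_mod: "Q (n mod l) = Q n"
proof -
  have "Q (r + l * d) = Q r" for r d
  proof (induction d)
    case (Suc d)
    have "r + l * Suc d = (r + l * d) + l" by simp
    with Suc show ?case by (simp only: Q_period)
  qed simp
  from this[of "n mod l" "n div l"] show ?thesis by simp
qed

lemma linear_nonzero: "C - \<zeta> ^ i * x \<noteq> 0"
proof
  assume "C - \<zeta> ^ i * x = 0"
  then have "C ^ l = (\<zeta> ^ i * x) ^ l" by simp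
  then have "y ^ l = 0" by (simp add: y power_mult_distrib zeta_power_l)
  then show False using y_nonzero by simp
qed

lemma z_power: "z ^ l = eps x"
  by (simp add: z eps_def)

lemma z_nonzero: "z \<noteq> 0"
proof
  assume "z = 0"
  then have "eps x = 0" using z_power[symmetric] l_pos by (simp add: power_0_left)
  then show False using linear_nonzero by (simp add: eps_def)
qed

lemma eps_mem: "eps x \<in> S1.E"
  unfolding eps_def using C \<zeta> S1.M_subset_E S1.theta_mem_E
  by (intro S1.E.closed) auto

lemma hom_eps:
  assumes "subset_hom S1.E \<sigma>" "\<And>a. a \<in> K \<Longrightarrow> \<sigma> a = a"
  shows "\<sigma> (eps x) = eps (\<sigma> x)"
proof -
  interpret \<sigma>: subset_hom S1.E \<sigma> by (rule assms)
  have mem: "C \<in> S1.E" "\<And>i. \<zeta> ^ i \<in> S1.E" using C \<zeta> S1.M_subset_E K.power_closed by auto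
  have lin: "\<sigma> (C - \<zeta> ^ i * x) = C - \<zeta> ^ i * \<sigma> x" for i
    using mem S1.theta_mem_E assms(2) C \<zeta> K.power_closed
    by (simp add: \<sigma>.hom_diff \<sigma>.hom_mult S1.E.mult_closed)
  have mem': "C - \<zeta> ^ i * x \<in> S1.E" for i
    using mem S1.theta_mem_E by (intro S1.E.diff_closed S1.E.mult_closed)
  show ?thesis unfolding eps_def
    by (subst \<sigma>.hom_prod) (auto intro!: S1.E.power_closed mem' simp: \<sigma>.hom_power mem' lin)
qed

lemma z_notin: "z \<notin> S2.E"
proof
  assume zE: "z \<in> S2.E"
  have "\<exists>\<tau>. subset_hom S2.E \<tau> \<and> (\<forall>a\<in>S1.E. \<tau> a = a) \<and> \<tau> y = \<zeta> * y"
  proof (rule S2.hom_extend)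
    show "subset_hom S1.E (\<lambda>a. a)" by unfold_locales auto
    show "(\<zeta> * y) ^ l = y ^ l" by (simp add: power_mult_distrib \<zeta>)
  qed
  then obtain \<tau> where \<tau>: "subset_hom S2.E \<tau>" "\<forall>a\<in>S1.E. \<tau> a = a" "\<tau> y = \<zeta> * y" by blast
  interpret \<tau>: subset_hom S2.E \<tau> by (rule \<tau>)
  have "\<tau> z ^ l = z ^ l" using \<tau>.hom_power[OF zE, of l] \<tau>(2) z_power eps_mem by simp
  then obtain j where j: "j < l" "\<tau> z = \<zeta> ^ j * z" using root_of_unity_multiple by blast
  have "\<exists>b\<in>S1.E. z = b * y ^ j"
    by (rule S2.eigenvector[OF \<tau>(1) _ \<tau>(3) zE j(2,1)]) (use \<tau> in auto)
  then obtain b where b: "b \<in> S1.E" "z = b * y ^ j" by blast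
  then have eb: "eps x = b ^ l * (y ^ l) ^ j"
    by (simp add: power_mult_distrib mult.commute flip: power_mult z_power)
  have "b \<noteq> 0" using b z_nonzero by auto
  obtain \<sigma> where \<sigma>: "subset_hom S1.E \<sigma>" "\<forall>a\<in>K. \<sigma> a = a" "\<sigma> x = \<zeta> * x"
    using S1_hom[of 1] by auto
  interpret \<sigma>: subset_hom S1.E \<sigma> by (rule \<sigma>)
  have mem: "C \<in> S1.E" "\<zeta> \<in> S1.E" "y ^ l \<in> S1.E"
    using C \<zeta> S1.M_subset_E y_power_mem by auto
  have "\<sigma> b \<in> S1.E"
    by (rule S1.hom_mem[OF \<sigma>(1) S1.E.unital_subring_axioms])
      (use \<sigma> b mem S1.M_subset_E S1.theta_mem_E in \<open>auto intro: S1.E.mult_closed\<close>)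
  have "eps (\<zeta> * x) = \<sigma> b ^ l * (y ^ l) ^ j"
    using arg_cong[OF eb, of \<sigma>] hom_eps[OF \<sigma>(1)] \<sigma>(2,3) b(1) mem y_power_mem
    by (simp add: \<sigma>.hom_mult \<sigma>.hom_power S1.E.power_closed)
  then have "\<sigma> b ^ l * (y ^ l) ^ j * y ^ l = b ^ l * (y ^ l) ^ j * (C - x) ^ l"
    using eps_shift[of x] eb by simp
  \<comment> \<open>Both sides carry the same power of \<open>y^l\<close>, which lies in
    \<open>K\<close> and is fixed by \<sigma>, so the unknown exponent \<open>j\<close> drops
    out.\<close>
  then have "(\<sigma> b * y) ^ l = (b * (C - x)) ^ l"
    using y_nonzero by (simp add: power_mult_distrib)
  then obtain i where "\<sigma> b * y = \<zeta> ^ i * (b * (C - x))" using root_of_unity_multiple by blast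
  moreover have "\<sigma> b \<noteq> 0" using \<sigma>.hom_eq_0_iff b \<open>b \<noteq> 0\<close> by auto
  ultimately have "y = \<zeta> ^ i * (b * (C - x)) / \<sigma> b" by (simp add: field_simps)
  also have "\<dots> \<in> S1.E"
    using mem b S1.theta_mem_E \<open>\<sigma> b \<in> S1.E\<close>
    by (intro S1.E.divide_closed S1.E.mult_closed S1.E.power_closed S1.E.diff_closed)
  finally show False using y_notin by blast
qed

lemma K_subset_S2: "K \<subseteq> S2.E"
  using S1.M_subset_E S2.M_subset_E by blast

sublocale S3: kummer_step S2.E l \<zeta> z
  by unfold_locales
    (use l \<zeta> z_notin z_power eps_mem K_subset_S2 S2.M_subset_E
      algebraic_over_superset[OF K_subset_S2] in auto)

abbreviation L :: "'a set" where "L \<equiv> S3.E"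

lemma K_subset_L: "K \<subseteq> L"
  using K_subset_S2 S3.M_subset_E by blast

lemma xyz_mem_L: "x \<in> L" "y \<in> L" "z \<in> L"
  using S1.theta_mem_E S2.theta_mem_E S3.theta_mem_E S2.M_subset_E S3.M_subset_E by auto

lemma L_subset: "field_subset N \<Longrightarrow> K \<subseteq> N \<Longrightarrow> x \<in> N \<Longrightarrow> y \<in> N \<Longrightarrow> z \<in> N \<Longrightarrow> L \<subseteq> N"
  by (intro S3.E_subset S2.E_subset S1.E_subset)

lemma L_eq_generate_field: "L = generate_field type_ring (K \<union> {x, y, z})"
proof -
  interpret R: field "type_ring :: 'a ring" ..
  show ?thesis
  proof (rule R.generate_fieldI)
    show "L \<subseteq> N" if "subfield N type_ring" "K \<union> {x, y, z} \<subseteq> N" for N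
      using that L_subset by (simp add: subfield_type_ring_iff)
  qed (use K_subset_L xyz_mem_L S3.field_subset_E in \<open>auto simp: subfield_type_ring_iff\<close>)
qed

lemma Q_mem: "Q n \<in> S2.E"
  unfolding Q_def using C \<zeta> K_subset_S2 S1.theta_mem_E S2.theta_mem_E S2.M_subset_E
  by (intro S2.E.divide_closed S2.E.prod_closed S2.E.diff_closed S2.E.mult_closed S2.E.power_closed) auto

lemma Q_nonzero: "Q n \<noteq> 0"
  using linear_nonzero y_nonzero by (simp add: Q_def)

section \<open>Automorphisms of the top field over the base field\<close>

definition Aut :: "('a \<Rightarrow> 'a) set" where
  "Aut = {\<sigma>. subset_hom L \<sigma> \<and> (\<forall>u\<in>K. \<sigma> u = u)}"

text \<open>The automorphism corresponding to the unitriangular matrix with entries \<open>a\<close>, \<open>b\<close>, \<open>c\<close> above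
  the diagonal, \<open>b\<close> being the corner.\<close>

definition acts :: "('a \<Rightarrow> 'a) \<Rightarrow> nat \<Rightarrow> nat \<Rightarrow> nat \<Rightarrow> bool" where
  "acts \<sigma> a b c \<longleftrightarrow> \<sigma> x = \<zeta> ^ c * x \<and> \<zeta> ^ a * \<sigma> y = y \<and> \<sigma> z = \<zeta> ^ b * (z * Q c)"

text \<open>The identity of \<open>K\<close> is extended through the three steps. The prescribed
  image of each generator has the right l-th power; for \<open>z\<close> this is
  \<open>eps_shift_power\<close>.\<close>

lemma acts_exists: "\<exists>\<sigma>\<in>Aut. acts \<sigma> a b c"
proof -
  obtain \<sigma>1 where \<sigma>1: "subset_hom S1.E \<sigma>1" "\<forall>a\<in>K. \<sigma>1 a = a" "\<sigma>1 x = \<zeta> ^ c * x"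
    using S1_hom by blast
  have "(inverse (\<zeta> ^ a) * y) ^ l = \<sigma>1 (y ^ l)"
    using \<sigma>1(2) y_power_mem
    by (simp only: power_mult_distrib power_inverse zeta_power_l inverse_1 mult_1_left)
  from S2.hom_extend[OF \<sigma>1(1) this] obtain \<sigma>2 where \<sigma>2: "subset_hom S2.E \<sigma>2" "\<forall>u\<in>S1.E. \<sigma>2 u = \<sigma>1 u" "\<sigma>2 y = inverse (\<zeta> ^ a) * y"
    by blast
  have "\<sigma>2 (z ^ l) = eps (\<zeta> ^ c * x)"
    using \<sigma>2(2) eps_mem hom_eps[OF \<sigma>1(1)] \<sigma>1(2,3) by (simp add: z_power)
  then have "(\<zeta> ^ b * (z * Q c)) ^ l = \<sigma>2 (z ^ l)"
    by (simp add: power_mult_distrib zeta_power_l eps_shift_power z_power)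
  from S3.hom_extend[OF \<sigma>2(1) this] obtain \<sigma> where \<sigma>:
    "subset_hom L \<sigma>" "\<forall>u\<in>S2.E. \<sigma> u = \<sigma>2 u" "\<sigma> z = \<zeta> ^ b * (z * Q c)" by blast
  have "\<sigma> u = u" if "u \<in> K" for u
    using that \<sigma>(2) \<sigma>1(2) \<sigma>2(2) S1.M_subset_E K_subset_S2 by (metis subsetD)
  moreover have "\<sigma> x = \<zeta> ^ c * x" "\<zeta> ^ a * \<sigma> y = y"
    using \<sigma>(2) \<sigma>1(3) \<sigma>2(2,3) S1.theta_mem_E S2.theta_mem_E S2.M_subset_E zeta_nonzero by auto
  ultimately show ?thesis using \<sigma> by (auto simp: Aut_def acts_def)
qed

lemma acts_mod: "acts \<sigma> (a mod l) (b mod l) (c mod l) \<longleftrightarrow> acts \<sigma> a b c"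
proof -
  have "\<zeta> ^ (n mod l) = \<zeta> ^ n" for n
    using \<zeta>(2) by (metis div_mult_mod_eq mult.commute mult.left_neutral power_add power_mult power_one)
  then show ?thesis by (simp add: acts_def Q_mod)
qed

lemma Aut_acts:
  assumes "\<sigma> \<in> Aut"
  shows "\<exists>a<l. \<exists>b<l. \<exists>c<l. acts \<sigma> a b c"
proof -
  interpret \<sigma>: subset_hom L \<sigma> using assms by (simp add: Aut_def)
  have fix_K: "\<sigma> u = u" if "u \<in> K" for u using that assms by (simp add: Aut_def)
  have hom1: "subset_hom S1.E \<sigma>"
    by (rule \<sigma>.subset_hom_subset) (use S1.field_subset_E S2.M_subset_E S3.M_subset_E in auto)
  have "\<sigma> x ^ l = x ^ l"
    using fix_K[OF x(1)] xyz_mem_L by (simp add: \<sigma>.hom_power)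
  then obtain c where c: "c < l" "\<sigma> x = \<zeta> ^ c * x" using root_of_unity_multiple by blast
  have "y ^ l = \<sigma> y ^ l"
    using fix_K[OF y_power_mem] xyz_mem_L by (simp add: \<sigma>.hom_power)
  then obtain a where a: "a < l" "y = \<zeta> ^ a * \<sigma> y" using root_of_unity_multiple by blast
  have "\<sigma> z ^ l = \<sigma> (eps x)"
    using z_power xyz_mem_L \<sigma>.hom_power by metis
  also have "\<dots> = (z * Q c) ^ l"
    using hom_eps[OF hom1 fix_K] c by (simp add: eps_shift_power power_mult_distrib z_power)
  finally obtain b where "b < l" "\<sigma> z = \<zeta> ^ b * (z * Q c)" using root_of_unity_multiple by blast
  then have "acts \<sigma> a b c" unfolding acts_def using c(2) a(2)[symmetric] by blast
  with a c \<open>b < l\<close> show ?thesis by blast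
qed

lemma acts_unique:
  assumes "acts \<sigma> a b c" "acts \<sigma> a' b' c'" "a < l" "a' < l" "b < l" "b' < l" "c < l" "c' < l"
  shows "a = a' \<and> b = b' \<and> c = c'"
proof -
  note inj = primitive_root_power_inj[OF \<zeta>(2,3)]
  have "\<zeta> ^ c = \<zeta> ^ c'" using assms(1,2) S1.theta_nonzero by (auto simp: acts_def)
  then have c: "c = c'" using assms inj by blast
  have "\<sigma> y \<noteq> 0" using assms(1) y_nonzero by (auto simp: acts_def)
  then have "\<zeta> ^ a = \<zeta> ^ a'"
    using assms(1,2) unfolding acts_def by (metis mult_right_cancel)
  then have a: "a = a'" using assms inj by blast
  have "\<zeta> ^ b = \<zeta> ^ b'"
    using assms(1,2) z_nonzero Q_nonzero c by (auto simp: acts_def)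
  then have "b = b'" using assms inj by blast
  with a c show ?thesis by blast
qed

lemma hom_eq_on_L:
  fixes \<sigma> \<tau> :: "'a \<Rightarrow> 'a"
  assumes "subset_hom L \<sigma>" "subset_hom L \<tau>" "\<And>a. a \<in> K \<Longrightarrow> \<sigma> a = \<tau> a"
    and "\<sigma> x = \<tau> x" "\<sigma> y = \<tau> y" "\<sigma> z = \<tau> z" "u \<in> L"
  shows "\<sigma> u = \<tau> u"
proof -
  have hom2: "subset_hom S2.E \<rho>" if "subset_hom L \<rho>" for \<rho> :: "'a \<Rightarrow> 'a"
    by (rule subset_hom.subset_hom_subset[OF that S2.field_subset_E S3.M_subset_E])
  have hom1: "subset_hom S1.E \<rho>" if "subset_hom L \<rho>" for \<rho> :: "'a \<Rightarrow> 'a"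
    by (rule subset_hom.subset_hom_subset[OF hom2[OF that] S1.field_subset_E S2.M_subset_E])
  have eq1: "\<sigma> v = \<tau> v" if "v \<in> S1.E" for v
    by (rule S1.hom_eq_on_E[OF hom1 hom1]) (use assms that in auto)
  have eq2: "\<sigma> v = \<tau> v" if "v \<in> S2.E" for v
    by (rule S2.hom_eq_on_E[OF hom2 hom2]) (use assms that eq1 in auto)
  show ?thesis
    by (rule S3.hom_eq_on_E) (use assms eq2 in auto)
qed

text \<open>\<open>Aut\<close> does not prescribe a codomain. Invariance of \<open>L\<close> follows
  from the images of \<open>x\<close>, \<open>y\<close> and \<open>z\<close>, carried up the tower
  by \<open>hom_mem\<close>.\<close>

lemma Aut_mem:
  assumes "\<sigma> \<in> Aut" "u \<in> L"
  shows "\<sigma> u \<in> L"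
proof -
  have hom: "subset_hom L \<sigma>" using assms by (simp add: Aut_def)
  obtain a b c where act: "acts \<sigma> a b c" using Aut_acts assms by blast
  have mem: "\<zeta> ^ i \<in> L" "Q i \<in> L" for i
    using \<zeta> K.power_closed K_subset_L Q_mem S3.M_subset_E by auto
  have hom2: "subset_hom S2.E \<sigma>"
    by (rule subset_hom.subset_hom_subset[OF hom S2.field_subset_E S3.M_subset_E])
  have hom1: "subset_hom S1.E \<sigma>"
    by (rule subset_hom.subset_hom_subset[OF hom2 S1.field_subset_E S2.M_subset_E])
  have "\<sigma> y = y / \<zeta> ^ a" using act zeta_nonzero by (auto simp: acts_def field_simps)
  then have imgs: "\<sigma> x \<in> L" "\<sigma> y \<in> L" "\<sigma> z \<in> L"
    using act mem xyz_mem_L by (auto simp: acts_def intro!: S3.E.mult_closed S3.E.divide_closed)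
  note sub = S3.E.unital_subring_axioms
  have 0: "\<sigma> v \<in> L" if "v \<in> K" for v
    using that K_subset_L assms by (auto simp: Aut_def)
  have 1: "\<sigma> v \<in> L" if "v \<in> S1.E" for v
    by (rule S1.hom_mem[OF hom1 sub]) (use 0 imgs that in auto)
  have 2: "\<sigma> v \<in> L" if "v \<in> S2.E" for v
    by (rule S2.hom_mem[OF hom2 sub]) (use 1 imgs that in auto)
  show ?thesis
    by (rule S3.hom_mem[OF hom sub]) (use 2 imgs assms in auto)
qed

text \<open>For surjectivity the generators are recovered in the image field in the order
  \<open>x\<close>, \<open>y\<close>, \<open>z\<close>; the order matters because
  \<open>Q c\<close>, needed for \<open>z\<close>, is built from \<open>x\<close> and
  \<open>y\<close>.\<close>

lemma Aut_bij:
  assumes "\<sigma> \<in> Aut"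
  shows "bij_betw \<sigma> L L"
proof -
  interpret \<sigma>: subset_hom L \<sigma> using assms by (simp add: Aut_def)
  obtain a b c where act: "acts \<sigma> a b c" using Aut_acts assms by blast
  interpret I: field_subset "\<sigma> ` L" by (rule \<sigma>.field_subset_image)
  have fix_K: "\<sigma> u = u" if "u \<in> K" for u using that assms by (simp add: Aut_def)
  have K: "K \<subseteq> \<sigma> ` L" using fix_K K_subset_L by (metis image_eqI subset_iff)
  then have \<zeta>I: "\<zeta> ^ i \<in> \<sigma> ` L" for i using \<zeta> K.power_closed by blast
  have imgs: "\<sigma> x \<in> \<sigma> ` L" "\<sigma> y \<in> \<sigma> ` L" "\<sigma> z \<in> \<sigma> ` L" using xyz_mem_L by auto
  have "x = \<sigma> x / \<zeta> ^ c" using act zeta_nonzero by (simp add: acts_def)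
  also have "\<dots> \<in> \<sigma> ` L" by (intro I.divide_closed imgs \<zeta>I)
  finally have xI: "x \<in> \<sigma> ` L" .
  have "y = \<zeta> ^ a * \<sigma> y" using act by (simp add: acts_def)
  also have "\<dots> \<in> \<sigma> ` L" by (intro I.mult_closed imgs \<zeta>I)
  finally have yI: "y \<in> \<sigma> ` L" .
  have QI: "Q c \<in> \<sigma> ` L" unfolding Q_def using xI yI \<zeta>I C K
    by (intro I.divide_closed I.prod_closed I.power_closed[OF yI] I.diff_closed I.mult_closed) auto
  have "z = \<sigma> z / (\<zeta> ^ b * Q c)" using act zeta_nonzero Q_nonzero by (simp add: acts_def)
  also have "\<dots> \<in> \<sigma> ` L" by (intro I.divide_closed I.mult_closed imgs \<zeta>I QI)
  finally have zI: "z \<in> \<sigma> ` L" .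
  have "L \<subseteq> \<sigma> ` L"
    by (rule L_subset) (use I.field_subset_axioms K xI yI zI in auto)
  moreover have "\<sigma> ` L \<subseteq> L" using Aut_mem assms by blast
  ultimately show ?thesis using \<sigma>.hom_inj by (auto simp: bij_betw_def)
qed

lemma Aut_comp:
  assumes "\<sigma> \<in> Aut" "\<tau> \<in> Aut"
  shows "(\<lambda>u. \<sigma> (\<tau> u)) \<in> Aut"
proof -
  interpret \<sigma>: subset_hom L \<sigma> using assms by (simp add: Aut_def)
  interpret \<tau>: subset_hom L \<tau> using assms by (simp add: Aut_def)
  have "subset_hom L (\<lambda>u. \<sigma> (\<tau> u))"
    by unfold_locales
      (use assms Aut_mem in \<open>auto simp: \<tau>.hom_add \<tau>.hom_mult \<tau>.hom_one \<sigma>.hom_add \<sigma>.hom_mult \<sigma>.hom_one\<close>)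
  then show ?thesis using assms by (auto simp: Aut_def)
qed

text \<open>\<sigma> turns the numerator of \<open>Q c'\<close> into the continuation of that of
  \<open>Q c\<close>, while the power of \<open>y\<close> in the denominator contributes
  \<open>\<zeta>^(a c')\<close>. This is the product of the unitriangular matrices, and it explains
  the sign in \<open>acts\<close>: \<open>y\<close> is multiplied by the inverse of
  \<open>\<zeta>^a\<close> because it stands in the denominator.\<close>

lemma acts_comp:
  assumes "\<sigma> \<in> Aut" "acts \<sigma> a b c" "acts \<tau> a' b' c'"
  shows "acts (\<lambda>u. \<sigma> (\<tau> u)) (a + a') (b + b' + a * c') (c + c')"
proof -
  interpret \<sigma>: subset_hom L \<sigma> using assms by (simp add: Aut_def)
  have fix_K: "\<sigma> u = u" if "u \<in> K" for u using that assms by (simp add: Aut_def)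
  have \<zeta>L: "\<zeta> ^ i \<in> L" and fix_\<zeta>: "\<sigma> (\<zeta> ^ i) = \<zeta> ^ i" for i
    using \<zeta> K.power_closed K_subset_L fix_K by auto
  have \<sigma>x: "\<sigma> x = \<zeta> ^ c * x" and \<sigma>y: "\<zeta> ^ a * \<sigma> y = y" and \<sigma>z: "\<sigma> z = \<zeta> ^ b * (z * Q c)"
    using assms(2) by (auto simp: acts_def)
  have \<tau>x: "\<tau> x = \<zeta> ^ c' * x" and \<tau>y: "\<zeta> ^ a' * \<tau> y = y" and \<tau>z: "\<tau> z = \<zeta> ^ b' * (z * Q c')"
    using assms(3) by (auto simp: acts_def)
  have "\<tau> y = y / \<zeta> ^ a'" using \<tau>y zeta_nonzero by (simp add: field_simps)
  then have y: "\<zeta> ^ (a + a') * \<sigma> (\<tau> y) = y"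
    using \<sigma>y zeta_nonzero xyz_mem_L \<zeta>L
    by (simp add: \<sigma>.hom_divide fix_\<zeta> power_add)
  have lin: "\<sigma> (C - \<zeta> ^ m * x) = C - \<zeta> ^ (c + m) * x" for m
    using C K_subset_L \<zeta>L xyz_mem_L fix_K
    by (simp add: \<sigma>.hom_diff \<sigma>.hom_mult S3.E.mult_closed fix_\<zeta> \<sigma>x subset_iff power_add ac_simps)
  have linL: "C - \<zeta> ^ m * x \<in> L" for m
    using C K_subset_L \<zeta>L xyz_mem_L by (intro S3.E.diff_closed S3.E.mult_closed) auto
  have prod: "\<sigma> (\<Prod>m<c'. C - \<zeta> ^ m * x) = (\<Prod>m<c'. C - \<zeta> ^ (c + m) * x)"
    by (subst \<sigma>.hom_prod) (auto simp: lin linL)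
  have "\<sigma> (Q c') = (\<Prod>m<c'. C - \<zeta> ^ (c + m) * x) / \<sigma> y ^ c'"
    unfolding Q_def using linL xyz_mem_L
    by (simp add: \<sigma>.hom_divide \<sigma>.hom_power S3.E.prod_closed S3.E.power_closed prod)
  also have "\<sigma> y = y / \<zeta> ^ a" using \<sigma>y zeta_nonzero by (simp add: field_simps)
  finally have "Q c * \<sigma> (Q c') = \<zeta> ^ (a * c') *
      ((\<Prod>m<c. C - \<zeta> ^ m * x) * (\<Prod>m<c'. C - \<zeta> ^ (c + m) * x) / y ^ (c + c'))"
    using zeta_nonzero y_nonzero
    by (simp add: Q_def power_divide field_simps power_add flip: power_mult)
  also have "(\<Prod>m<c. C - \<zeta> ^ m * x) * (\<Prod>m<c'. C - \<zeta> ^ (c + m) * x) = (\<Prod>m<c + c'. C - \<zeta> ^ m * x)"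
    by (simp add: prod_lessThan_add)
  finally have "Q c * \<sigma> (Q c') = \<zeta> ^ (a * c') * Q (c + c')" by (simp add: Q_def)
  moreover have "\<sigma> (\<tau> z) = \<zeta> ^ b' * (\<zeta> ^ b * z * (Q c * \<sigma> (Q c')))"
  proof -
    have "Q c' \<in> L" using Q_mem S3.M_subset_E by auto
    then show ?thesis
      unfolding \<tau>z using xyz_mem_L \<zeta>L
      by (simp add: \<sigma>.hom_mult S3.E.mult_closed fix_\<zeta> \<sigma>z ac_simps)
  qed
  ultimately have z: "\<sigma> (\<tau> z) = \<zeta> ^ (b + b' + a * c') * (z * Q (c + c'))"
    by (simp add: power_add ac_simps)
  have "\<sigma> (\<tau> x) = \<zeta> ^ (c + c') * x"
    unfolding \<tau>x using xyz_mem_L \<zeta>L by (simp add: \<sigma>.hom_mult fix_\<zeta> \<sigma>x power_add ac_simps)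
  with y z show ?thesis by (simp add: acts_def)
qed

text \<open>The element descends the tower step by step. At each step one automorphism suffices that
  fixes the lower field and multiplies the generator by \<zeta>.\<close>

lemma Aut_fixed_imp_mem:
  assumes "u \<in> L" "\<And>\<sigma>. \<sigma> \<in> Aut \<Longrightarrow> \<sigma> u = u"
  shows "u \<in> K"
proof -
  have hom2: "subset_hom S2.E \<rho>" if "subset_hom L \<rho>" for \<rho> :: "'a \<Rightarrow> 'a"
    by (rule subset_hom.subset_hom_subset[OF that S2.field_subset_E S3.M_subset_E])
  have hom1: "subset_hom S1.E \<rho>" if "subset_hom L \<rho>" for \<rho> :: "'a \<Rightarrow> 'a"
    by (rule subset_hom.subset_hom_subset[OF hom2[OF that] S1.field_subset_E S2.M_subset_E])
  have hom: "subset_hom L \<sigma>" and fix_K: "\<And>v. v \<in> K \<Longrightarrow> \<sigma> v = v" if "\<sigma> \<in> Aut" for \<sigma>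
    using that by (auto simp: Aut_def)
  have id1: "subset_hom S1.E (\<lambda>u. u)" and id2: "subset_hom S2.E (\<lambda>u. u)" by unfold_locales auto
  have fix1: "\<sigma> v = v" if "\<sigma> \<in> Aut" "\<sigma> x = x" "v \<in> S1.E" for \<sigma> v
    by (rule S1.hom_eq_on_E[of \<sigma>, OF hom1[OF hom[OF that(1)]] id1 fix_K[OF that(1)] that(2,3)])
  have fix2: "\<sigma> v = v" if "\<sigma> \<in> Aut" "\<sigma> x = x" "\<sigma> y = y" "v \<in> S2.E" for \<sigma> v
    by (rule S2.hom_eq_on_E[of \<sigma>, OF hom2[OF hom[OF that(1)]] id2 fix1[OF that(1,2)] that(3,4)])
  have u2: "u \<in> S2.E"
  proof -
    obtain \<sigma> where \<sigma>: "\<sigma> \<in> Aut" "acts \<sigma> 0 1 0"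
      using acts_exists[of 0 1 0] by blast
    then have "\<sigma> x = x" "\<sigma> y = y" "\<sigma> z = \<zeta> * z" by (simp_all add: acts_def Q_def)
    then show ?thesis
      using S3.fixed_mem[OF hom[OF \<sigma>(1)] fix2[OF \<sigma>(1)] _ assms(1) assms(2)[OF \<sigma>(1)]] by blast
  qed
  have u1: "u \<in> S1.E"
  proof -
    \<comment> \<open>The exponent is \<open>l - 1\<close> because \<open>acts\<close> multiplies
      \<open>y\<close> by the inverse of \<open>\<zeta>^a\<close>, and \<zeta> itself is
      wanted.\<close>
    obtain \<sigma> where \<sigma>: "\<sigma> \<in> Aut" "acts \<sigma> (l - 1) 0 0"
      using acts_exists[of "l - 1" 0 0] by blast
    have "\<zeta> * \<zeta> ^ (l - 1) = 1" using \<zeta>(2) l_pos by (metis One_nat_def Suc_pred power_Suc)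
    moreover have "\<zeta> ^ (l - 1) * \<sigma> y = y" using \<sigma>(2) by (simp add: acts_def)
    ultimately have "\<sigma> y = \<zeta> * y" by (metis mult.assoc mult.left_neutral)
    moreover have "\<sigma> x = x" using \<sigma>(2) by (simp add: acts_def)
    ultimately show ?thesis
      using S2.fixed_mem[OF hom2[OF hom[OF \<sigma>(1)]] fix1[OF \<sigma>(1)] _ u2 assms(2)[OF \<sigma>(1)]] by blast
  qed
  obtain \<sigma> where \<sigma>: "\<sigma> \<in> Aut" "acts \<sigma> 0 0 1"
      using acts_exists[of 0 0 1] by blast
  have "\<sigma> x = \<zeta> * x" using \<sigma>(2) by (simp add: acts_def)
  then show ?thesis
    using S1.fixed_mem[OF hom1[OF hom[OF \<sigma>(1)]] fix_K[OF \<sigma>(1)] _ u1 assms(2)[OF \<sigma>(1)]] by blast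
qed

end


section \<open>Galois group and ramification of the tower\<close>

lemma polys_over_simps:
  "p \<otimes>\<^bsub>polys_over K\<^esub> q = p * q" "\<one>\<^bsub>polys_over K\<^esub> = 1" "\<zero>\<^bsub>polys_over K\<^esub> = 0"
  by (simp_all add: polys_over_def ring_of_type_algebra_def)

lemma (in field_subset) degree_Units_polys_over:
  assumes "p \<in> Units (polys_over M)"
  shows "Polynomial.degree p = 0"
proof -
  obtain q where "p * q = 1" using assms by (auto simp: Units_def polys_over_simps)
  then have "is_unit p" by (metis dvdI)
  moreover from this have "p \<noteq> 0" by auto
  ultimately show ?thesis by (simp add: is_unit_iff_degree)
qed

text \<open>Irreducibility speaks of proper divisors. Either \<open>q\<close> is one, hence a unit
  and constant, or \<open>p\<close> divides \<open>q\<close> and comparing degrees leaves nothing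
  for \<open>h\<close>.\<close>

lemma (in field_subset) irreducible_over_factor:
  assumes p: "irreducible_over M p" "p = q * h" and q: "q \<in> polys M" "h \<in> polys M"
  shows "Polynomial.degree q = 0 \<or> Polynomial.degree h = 0"
proof (cases "p divides\<^bsub>polys_over M\<^esub> q")
  case True
  have p0: "p \<noteq> 0" using p(1) by (simp add: ring_irreducible_def polys_over_simps)
  from True obtain g where g: "q = p * g" by (auto simp: factor_def polys_over_simps)
  have "q \<noteq> 0" "h \<noteq> 0" "g \<noteq> 0" using p0 p(2) g mult_eq_0_iff by metis+
  have "Polynomial.degree p = Polynomial.degree q + Polynomial.degree h"
    unfolding p(2) using \<open>q \<noteq> 0\<close> \<open>h \<noteq> 0\<close> by (rule degree_mult_eq)
  moreover have "Polynomial.degree q = Polynomial.degree p + Polynomial.degree g"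
    unfolding g using p0 \<open>g \<noteq> 0\<close> by (rule degree_mult_eq)
  ultimately show ?thesis by simp
next
  case False
  have "q divides\<^bsub>polys_over M\<^esub> p" using p(2) q by (auto simp: factor_def polys_over_simps)
  then have "q \<in> Units (polys_over M)"
    using p(1) q False by (auto simp: ring_irreducible_def Divisibility.irreducible_def properfactor_def)
  then show ?thesis using degree_Units_polys_over by blast
qed

lemma degree_prod_linear: "Polynomial.degree (\<Prod>v\<in>S. [:- v, 1:] :: 'a::field poly) = card S"
  by (subst degree_prod_eq_sum_degree) auto

text \<open>At a simple root the derivative does not vanish, so a common divisor \<open>d\<close>
  has no root in \<open>S\<close>. The cofactor of \<open>d\<close> then has all of \<open>S\<close>
  as roots, hence the full degree, and \<open>d\<close> is constant.\<close>

lemma coprime_pderiv_prod_linear: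
  fixes S :: "'a::field set"
  assumes S: "finite S" and a: "a \<noteq> 0" and p: "p = Polynomial.smult a (\<Prod>v\<in>S. [:- v, 1:])"
  shows "Rings.coprime p (pderiv p)"
proof (rule coprimeI)
  fix d assume d: "d dvd p" "d dvd pderiv p"
  define q where "q = (\<Prod>v\<in>S. [:- v, 1:])"
  have "d dvd q" using d(1) a by (simp add: p q_def dvd_smult_iff)
  then obtain e where e: "q = d * e" by (elim dvdE)
  have "q \<noteq> 0" using S by (simp add: q_def)
  then have nz: "d \<noteq> 0" "e \<noteq> 0" unfolding e by auto
  have no_root: "poly d v \<noteq> 0" if v: "v \<in> S" for v
  proof
    assume "poly d v = 0"
    moreover obtain g where "pderiv p = d * g" using d(2) by (elim dvdE)
    ultimately have "poly (pderiv p) v = 0" by (simp del: pderiv_eq_0_iff)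
    moreover have "q = [:- v, 1:] * (\<Prod>u\<in>S - {v}. [:- u, 1:])"
      unfolding q_def using S v by (rule prod.remove)
    then have "poly (pderiv p) v = a * poly (\<Prod>u\<in>S - {v}. [:- u, 1:]) v"
      by (simp only: p pderiv_smult pderiv_mult flip: q_def) (simp add: pderiv_pCons)
    then have "poly (pderiv p) v = a * (\<Prod>u\<in>S - {v}. v - u)"
      by (simp add: poly_prod)
    ultimately show False using a S by simp
  qed
  have "S \<subseteq> {v. poly e v = 0}"
  proof
    fix v assume v: "v \<in> S"
    have "poly q v = 0" using S v by (simp add: q_def poly_prod)
    then show "v \<in> {v. poly e v = 0}" using no_root[OF v] by (simp add: e)
  qed
  then have "card S \<le> card {v. poly e v = 0}"
    using nz poly_roots_finite by (intro card_mono) auto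
  also have "\<dots> \<le> Polynomial.degree e" using nz by (intro card_poly_roots_bound)
  finally have "card S \<le> Polynomial.degree e" .
  moreover have "card S = Polynomial.degree d + Polynomial.degree e"
    using nz e degree_prod_linear[of S] by (simp add: q_def degree_mult_eq)
  ultimately show "is_unit d" using nz by (simp add: is_unit_iff_degree)
qed

section \<open>Unitriangular matrices over the integers modulo l\<close>

definition unitriangular :: "int \<Rightarrow> int \<Rightarrow> int \<Rightarrow> int ^ 3 ^ 3" where
  "unitriangular a b c = vector [vector [1, a, b], vector [0, 1, c], vector [0, 0, 1]]"

lemma unitriangular_eq_iff:
  "unitriangular a b c = unitriangular a' b' c' \<longleftrightarrow> a = a' \<and> b = b' \<and> c = c'"
  by (auto simp: unitriangular_def vec_eq_iff forall_3)

lemma carrier_heisenberg_residue_ring: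
  assumes "l > 1"
  shows "carrier (heisenberg_group (residue_ring (int l))) =
    {unitriangular (int a) (int b) (int c) | a b c. a < l \<and> b < l \<and> c < l}"
proof -
  have 1: "{0..int l - 1} = int ` {..<l}"
    by (auto simp: lessThan_atLeast0 image_int_atLeastLessThan)
  show ?thesis
    by (auto simp: heisenberg_group_def residue_ring_def unitriangular_def 1)
qed

lemma heisenberg_mult_residue_ring:
  assumes "l > 1" "a < l" "b < l" "c < l" "a' < l" "b' < l" "c' < l"
  shows "unitriangular (int a) (int b) (int c) \<otimes>\<^bsub>heisenberg_group (residue_ring (int l))\<^esub>
      unitriangular (int a') (int b') (int c') =
    unitriangular (int ((a + a') mod l)) (int ((b + b' + a * c') mod l)) (int ((c + c') mod l))"
proof -
  interpret residues "int l" "residue_ring (int l)"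
    by unfold_locales (use assms in auto)
  have sum: "(\<Oplus>\<^bsub>residue_ring (int l)\<^esub>m\<in>UNIV. f m) = (f 1 + f 2 + f 3) mod int l"
    if "\<And>m. f m \<in> {0..int l - 1}" for f :: "3 \<Rightarrow> int"
    unfolding UNIV_3 using that by (simp add: res_add_eq res_zero_eq res_carrier_eq mod_simps ac_simps)
  have entry: "(A \<otimes>\<^bsub>heisenberg_group (residue_ring (int l))\<^esub> B) $ i $ j =
      (A $ i $ 1 * B $ 1 $ j + A $ i $ 2 * B $ 2 $ j + A $ i $ 3 * B $ 3 $ j) mod int l" for A B i j
  proof -
    have "(A \<otimes>\<^bsub>heisenberg_group (residue_ring (int l))\<^esub> B) $ i $ j =
        (\<Oplus>\<^bsub>residue_ring (int l)\<^esub>m\<in>UNIV. A $ i $ m * B $ m $ j mod int l)"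
      by (simp add: heisenberg_group_def res_mult_eq)
    also have "\<dots> = (A $ i $ 1 * B $ 1 $ j mod int l + A $ i $ 2 * B $ 2 $ j mod int l
        + A $ i $ 3 * B $ 3 $ j mod int l) mod int l"
      by (rule sum) (use assms(1) in simp)
    also have "\<dots> = (A $ i $ 1 * B $ 1 $ j + A $ i $ 2 * B $ 2 $ j + A $ i $ 3 * B $ 3 $ j) mod int l"
      by (intro mod_add_cong mod_mod_trivial)
    finally show ?thesis .
  qed
  show ?thesis
    unfolding vec_eq_iff forall_3 entry
    using assms by (simp add: unitriangular_def zmod_int algebra_simps)
qed

context heisenberg_tower
begin

section \<open>Orbit polynomials, normality and separability\<close>

lemma poly_root_Aut:
  assumes "\<sigma> \<in> Aut" "p \<in> polys K" "u \<in> L" "poly p u = 0"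
  shows "poly p (\<sigma> u) = 0"
proof -
  interpret \<sigma>: subset_hom L \<sigma> using assms by (simp add: Aut_def)
  have "map_poly \<sigma> p = p"
    using assms by (intro poly_eqI) (auto simp: \<sigma>.coeff_map_hom polys_iff Aut_def)
  moreover have "p \<in> polys L" using assms(2) K_subset_L by (auto simp: polys_iff)
  ultimately show ?thesis
    using \<sigma>.poly_map_hom[of p u] assms \<sigma>.hom_zero by simp
qed

text \<open>Up to a constant, \<open>p\<close> is the orbit polynomial of its root \<open>u\<close>.
  The product runs over a set, so the roots are distinct, and the lemma serves for normality and
  separability alike. Finiteness of the orbit comes from the roots of \<open>p\<close>, not from
  \<open>Aut\<close>, whose members are unconstrained outside \<open>L\<close>.\<close>

lemma irreducible_over_split:
  assumes p: "irreducible_over K p" and u: "u \<in> L" "poly p u = 0"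
  obtains a S where "finite S" "S \<subseteq> L" "a \<noteq> 0" "p = Polynomial.smult a (\<Prod>v\<in>S. [:- v, 1:])"
proof -
  define S where "S = (\<lambda>\<sigma>. \<sigma> u) ` Aut"
  have p0: "p \<noteq> 0" using p by (simp add: ring_irreducible_def polys_over_simps)
  have pK: "p \<in> polys K" using p by blast
  have S_roots: "S \<subseteq> {v. poly p v = 0}"
    using poly_root_Aut pK u by (auto simp: S_def)
  then have fin: "finite S" using poly_roots_finite[OF p0] finite_subset by blast
  have SL: "S \<subseteq> L" using Aut_mem u by (auto simp: S_def)
  have "S \<noteq> {}" using acts_exists by (auto simp: S_def)
  define q where "q = (\<Prod>v\<in>S. [:- v, 1:])"
  have qL: "q \<in> polys L"
    unfolding q_def using SL by (intro S3.E.polys_closed S3.E.linear_polys) auto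
  have "map_poly \<sigma> q = q" if \<sigma>: "\<sigma> \<in> Aut" for \<sigma>
  proof -
    interpret \<sigma>: subset_hom L \<sigma> using \<sigma> by (simp add: Aut_def)
    have inj: "inj_on \<sigma> S" using \<sigma>.hom_inj SL by (rule inj_on_subset)
    have "\<sigma> ` S \<subseteq> S" using Aut_comp[OF \<sigma>] by (auto simp: S_def)
    then have im: "\<sigma> ` S = S" using endo_inj_surj fin inj by blast
    have "map_poly \<sigma> q = (\<Prod>v\<in>S. map_poly \<sigma> [:- v, 1:])"
      unfolding q_def using SL by (intro \<sigma>.map_poly_hom_prod S3.E.linear_polys) auto
    also have "\<dots> = (\<Prod>v\<in>S. [:- \<sigma> v, 1:])"
      using SL by (intro prod.cong) (auto simp: \<sigma>.map_poly_hom_pCons \<sigma>.hom_uminus \<sigma>.hom_one)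
    also have "\<dots> = (\<Prod>v\<in>\<sigma> ` S. [:- v, 1:])"
      by (simp add: prod.reindex[OF inj])
    finally show ?thesis by (simp add: im q_def)
  qed
  then have "\<sigma> (Polynomial.coeff q i) = Polynomial.coeff q i" if "\<sigma> \<in> Aut" for \<sigma> i
    using that subset_hom.coeff_map_hom[of L \<sigma> q i] by (simp add: Aut_def)
  then have qK: "q \<in> polys K"
    using qL Aut_fixed_imp_mem by (auto simp: polys_iff)
  have degq: "Polynomial.degree q = card S" by (simp add: q_def degree_prod_linear)
  have lead: "Polynomial.lead_coeff q = 1" by (simp add: q_def lead_coeff_prod)
  from K.monic_division[OF qK lead pK] obtain h r where hr: "h \<in> polys K" "r \<in> polys K"
    "p = q * h + r" "\<And>i. i \<ge> card S \<Longrightarrow> Polynomial.coeff r i = 0"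
    unfolding degq by blast
  \<comment> \<open>The remainder has degree below \<open>card S\<close> but vanishes on all of
    \<open>S\<close>, since both \<open>p\<close> and \<open>q\<close> do.\<close>
  have "r = 0"
  proof (rule ccontr)
    assume r0: "r \<noteq> 0"
    have "poly r v = 0" if "v \<in> S" for v
    proof -
      have "poly q v = 0" using that fin by (simp add: q_def poly_prod)
      moreover have "poly p v = 0" using S_roots that by blast
      ultimately show ?thesis using hr(3) by simp
    qed
    then have "card S \<le> card {v. poly r v = 0}"
      using r0 poly_roots_finite by (intro card_mono) auto
    also have "\<dots> \<le> Polynomial.degree r" using r0 by (intro card_poly_roots_bound)
    finally show False using hr(4)[of "Polynomial.degree r"] r0 by simp
  qed
  then have pqh: "p = q * h" using hr by simp
  have "card S > 0" using fin \<open>S \<noteq> {}\<close> by (simp add: card_gt_0_iff)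
  then have "Polynomial.degree h = 0"
    using K.irreducible_over_factor[OF p pqh qK hr(1)] degq by simp
  then obtain a where "h = [:a:]" by (meson degree_eq_zeroE)
  then have "p = Polynomial.smult a q" using pqh by simp
  moreover from this have "a \<noteq> 0" using p0 by auto
  ultimately show ?thesis using that[of S a] fin SL by (simp add: q_def)
qed

lemma galois_extension_L: "galois_extension K L"
  unfolding galois_extension_def
proof (intro conjI)
  show "subfield K type_ring" "subfield L type_ring"
    by (simp_all add: subfield_type_ring_iff K.field_subset_axioms S3.field_subset_E)
  show "K \<subseteq> L" by (rule K_subset_L)
  show "\<forall>u\<in>L. (ring.algebraic type_ring over K) u" using algebraic by blast
  show "normal_extension K L"
    unfolding normal_extension_def
  proof (intro allI impI; elim conjE bexE)
    fix p u assume "p \<in> polys K" "ring_irreducible\<^bsub>polys_over K\<^esub> p" "u \<in> L" "poly p u = 0"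
    then obtain a S where S: "finite S" "S \<subseteq> L" "p = Polynomial.smult a (\<Prod>v\<in>S. [:- v, 1:])"
      using irreducible_over_split[of p u] by metis
    then obtain xs where "set xs = S" "distinct xs" using finite_distinct_list by blast
    with S show "\<exists>a xs. set xs \<subseteq> L \<and> p = Polynomial.smult a (\<Prod>x\<leftarrow>xs. [:- x, 1:])"
      by (metis prod.distinct_set_conv_list)
  qed
  show "separable_extension K L"
    unfolding separable_extension_def
  proof (intro allI impI; elim conjE bexE)
    fix p u assume "p \<in> polys K" "ring_irreducible\<^bsub>polys_over K\<^esub> p" "u \<in> L" "poly p u = 0"
    then obtain a S where "finite S" "a \<noteq> 0" "p = Polynomial.smult a (\<Prod>v\<in>S. [:- v, 1:])"
      using irreducible_over_split[of p u] by metis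
    then show "Rings.coprime p (pderiv p)" by (rule coprime_pderiv_prod_linear)
  qed
qed

section \<open>Identification of the Galois group\<close>

lemma carrier_galois_group: "carrier (galois_group K L) = Aut \<inter> extensional L"
proof -
  have "\<sigma> \<in> ring_iso (type_ring\<lparr>carrier := L\<rparr>) (type_ring\<lparr>carrier := L\<rparr>) \<and> (\<forall>u\<in>K. \<sigma> u = u)
      \<longleftrightarrow> \<sigma> \<in> Aut" for \<sigma>
  proof (intro iffI conjI)
    assume \<sigma>: "\<sigma> \<in> ring_iso (type_ring\<lparr>carrier := L\<rparr>) (type_ring\<lparr>carrier := L\<rparr>) \<and> (\<forall>u\<in>K. \<sigma> u = u)"
    then have "subset_hom L \<sigma>"
      by unfold_locales
        (auto simp: ring_iso_def dest: ring_hom_add ring_hom_mult ring_hom_one)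
    with \<sigma> show "\<sigma> \<in> Aut" by (simp add: Aut_def)
  next
    assume \<sigma>: "\<sigma> \<in> Aut"
    interpret \<sigma>: subset_hom L \<sigma> using \<sigma> by (simp add: Aut_def)
    show "\<forall>u\<in>K. \<sigma> u = u" using \<sigma> by (simp add: Aut_def)
    have "\<sigma> \<in> ring_hom (type_ring\<lparr>carrier := L\<rparr>) (type_ring\<lparr>carrier := L\<rparr>)"
      by (rule ring_hom_memI)
        (use \<sigma> in \<open>auto simp: Aut_mem \<sigma>.hom_add \<sigma>.hom_mult \<sigma>.hom_one\<close>)
    then show "\<sigma> \<in> ring_iso (type_ring\<lparr>carrier := L\<rparr>) (type_ring\<lparr>carrier := L\<rparr>)"
      using Aut_bij[OF \<sigma>] by (simp add: ring_iso_def)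
  qed
  then show ?thesis by (auto simp: galois_group_def Let_def)
qed

lemma mult_galois_group:
  assumes "\<sigma> \<in> carrier (galois_group K L)" "\<tau> \<in> carrier (galois_group K L)"
  shows "\<sigma> \<otimes>\<^bsub>galois_group K L\<^esub> \<tau> = compose L \<sigma> \<tau>"
proof -
  have "\<sigma> \<in> Bij L" "\<tau> \<in> Bij L"
    using assms Aut_bij by (auto simp: carrier_galois_group Bij_def)
  then show ?thesis by (simp add: galois_group_def Let_def BijGroup_def)
qed

lemma Aut_cong:
  assumes "\<sigma> \<in> Aut" "\<And>u. u \<in> L \<Longrightarrow> \<tau> u = \<sigma> u"
  shows "\<tau> \<in> Aut" "acts \<tau> a b c = acts \<sigma> a b c"
proof -
  interpret \<sigma>: subset_hom L \<sigma> using assms by (simp add: Aut_def)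
  have "subset_hom L \<tau>"
    by unfold_locales
      (use assms in \<open>auto simp: \<sigma>.hom_add \<sigma>.hom_mult \<sigma>.hom_one S3.E.closed\<close>)
  then show "\<tau> \<in> Aut" using assms K_subset_L by (auto simp: Aut_def)
  show "acts \<tau> a b c = acts \<sigma> a b c" using assms xyz_mem_L by (simp add: acts_def)
qed

lemma galois_group_iso_heisenberg:
  "galois_group K L \<cong> heisenberg_group (residue_ring (int l))"
proof -
  let ?G = "galois_group K L" and ?H = "heisenberg_group (residue_ring (int l))"
  \<comment> \<open>The matrix of exponents by which \<sigma> acts on the generators; the choice is
    unique by \<open>acts_unique\<close>, as the exponents are reduced modulo
    \<open>l\<close>.\<close>
  define \<psi> where "\<psi> \<sigma> = (SOME A. \<exists>a<l. \<exists>b<l. \<exists>c<l. acts \<sigma> a b c \<and>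
    A = unitriangular (int a) (int b) (int c))" for \<sigma>
  have \<psi>: "\<psi> \<sigma> = unitriangular (int a) (int b) (int c)"
    if "acts \<sigma> a b c" "a < l" "b < l" "c < l" for \<sigma> a b c
    unfolding \<psi>_def by (rule some_equality) (use that acts_unique in blast)+
  have act: "\<exists>a<l. \<exists>b<l. \<exists>c<l. acts \<sigma> a b c" if "\<sigma> \<in> carrier ?G" for \<sigma>
    using that Aut_acts by (simp add: carrier_galois_group)
  have \<psi>_carrier: "\<psi> \<sigma> \<in> carrier ?H" if \<sigma>: "\<sigma> \<in> carrier ?G" for \<sigma>
  proof -
    obtain a b c where abc: "a < l" "b < l" "c < l" "acts \<sigma> a b c" using act[OF \<sigma>] by blast
    show ?thesis
      unfolding \<psi>[OF abc(4,1-3)] carrier_heisenberg_residue_ring[OF l_gt_1] using abc by blast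
  qed
  have "\<psi> \<in> hom ?G ?H"
  proof (rule homI)
    show "\<psi> \<sigma> \<in> carrier ?H" if "\<sigma> \<in> carrier ?G" for \<sigma>
      by (rule \<psi>_carrier[OF that])
  next
    fix \<sigma> \<tau> assume \<sigma>: "\<sigma> \<in> carrier ?G" and \<tau>: "\<tau> \<in> carrier ?G"
    obtain a b c where abc: "a < l" "b < l" "c < l" "acts \<sigma> a b c" using act[OF \<sigma>] by blast
    obtain a' b' c' where abc': "a' < l" "b' < l" "c' < l" "acts \<tau> a' b' c'" using act[OF \<tau>] by blast
    have Aut: "\<sigma> \<in> Aut" "\<tau> \<in> Aut" using \<sigma> \<tau> by (auto simp: carrier_galois_group)
    have "acts (compose L \<sigma> \<tau>) (a + a') (b + b' + a * c') (c + c')"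
      using acts_comp[OF Aut(1) abc(4) abc'(4)] Aut_cong(2)[OF Aut_comp[OF Aut], of "compose L \<sigma> \<tau>"]
      by (simp add: compose_eq)
    then have "acts (compose L \<sigma> \<tau>) ((a + a') mod l) ((b + b' + a * c') mod l) ((c + c') mod l)"
      by (simp only: acts_mod)
    then show "\<psi> (\<sigma> \<otimes>\<^bsub>?G\<^esub> \<tau>) = \<psi> \<sigma> \<otimes>\<^bsub>?H\<^esub> \<psi> \<tau>"
      using abc abc' l_gt_1 l_pos
      by (simp add: mult_galois_group[OF \<sigma> \<tau>] \<psi> heisenberg_mult_residue_ring)
  qed
  moreover have "bij_betw \<psi> (carrier ?G) (carrier ?H)"
  proof (rule bij_betwI')
    fix \<sigma> \<tau> assume \<sigma>: "\<sigma> \<in> carrier ?G" and \<tau>: "\<tau> \<in> carrier ?G"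
    obtain a b c where abc: "a < l" "b < l" "c < l" "acts \<sigma> a b c" using act[OF \<sigma>] by blast
    obtain a' b' c' where abc': "a' < l" "b' < l" "c' < l" "acts \<tau> a' b' c'" using act[OF \<tau>] by blast
    show "\<psi> \<sigma> = \<psi> \<tau> \<longleftrightarrow> \<sigma> = \<tau>"
    proof
      assume "\<psi> \<sigma> = \<psi> \<tau>"
      then have eq: "a = a'" "b = b'" "c = c'"
        using abc abc' by (simp_all add: \<psi> unitriangular_eq_iff)
      have Aut: "\<sigma> \<in> Aut" "\<tau> \<in> Aut" using \<sigma> \<tau> by (auto simp: carrier_galois_group)
      have y: "\<sigma> y = \<tau> y" using abc(4) abc'(4) zeta_nonzero eq unfolding acts_def
        by (metis mult_left_cancel power_not_zero)
      have x: "\<sigma> x = \<tau> x" and z: "\<sigma> z = \<tau> z"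
        using abc(4) abc'(4) eq by (auto simp: acts_def)
      have "\<sigma> u = \<tau> u" if "u \<in> L" for u
        by (rule hom_eq_on_L[OF _ _ _ x y z that]) (use Aut in \<open>auto simp: Aut_def\<close>)
      then show "\<sigma> = \<tau>" using \<sigma> \<tau> by (intro extensionalityI[of _ L]) (auto simp: carrier_galois_group)
    qed simp
  next
    show "\<psi> \<sigma> \<in> carrier ?H" if "\<sigma> \<in> carrier ?G" for \<sigma>
      by (rule \<psi>_carrier[OF that])
  next
    fix A assume "A \<in> carrier ?H"
    then obtain a b c where abc: "a < l" "b < l" "c < l" "A = unitriangular (int a) (int b) (int c)"
      using l_gt_1 by (auto simp: carrier_heisenberg_residue_ring)
    obtain \<sigma> where \<sigma>: "\<sigma> \<in> Aut" "acts \<sigma> a b c" using acts_exists by blast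
    have "restrict \<sigma> L \<in> carrier ?G" "acts (restrict \<sigma> L) a b c"
      using Aut_cong[OF \<sigma>(1), of "restrict \<sigma> L"] \<sigma>(2) by (auto simp: carrier_galois_group)
    then show "\<exists>\<sigma>\<in>carrier ?G. A = \<psi> \<sigma>" using \<psi> abc by metis
  qed
  ultimately show ?thesis by (auto simp: is_iso_def iso_def)
qed

text \<open>The hypotheses make \<open>l\<close>, the \<open>\<zeta>^i - 1\<close>,
  \<open>C\<close>, \<open>x\<close> and \<open>y\<close> units. For \<open>z\<close>, the factors
  \<open>C - \<zeta>^i x\<close> have nonnegative values whose sum is the value of
  \<open>y^l\<close>, namely 0; so each is a unit, and so is \<open>eps x\<close>. The Kummer steps
  then apply from the top down.\<close>

lemma value_group:
  assumes "valuation_on L w"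
    and wl: "(of_nat l :: 'a) \<noteq> 0" "w (of_nat l) = 0"
    and w\<zeta>: "\<And>i. 0 < i \<Longrightarrow> i < l \<Longrightarrow> w (\<zeta> ^ i - 1) = 0" and wC: "C \<noteq> 0" "w C = 0"
    and w_xy: "w (x ^ l) = 0" "w (y ^ l) = 0"
    and u: "u \<in> L" "u \<noteq> 0"
  shows "\<exists>b\<in>K. b \<noteq> 0 \<and> w u = w b"
proof -
  interpret valuation_on L w by (rule assms)
  have wx: "w x = 0" and wy: "w y = 0"
    using val_power[of x l] val_power[of y l] w_xy xyz_mem_L S1.theta_nonzero y_nonzero l_pos by auto
  have \<zeta>L: "\<zeta> ^ i \<in> L" and CL: "C \<in> L" for i using \<zeta> C K.power_closed K_subset_L by auto
  have w\<zeta>i: "w (\<zeta> ^ i) = 0" for i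
    using val_power[of "\<zeta> ^ i" l] zeta_power_l \<zeta>L zeta_nonzero val_one l_pos by auto
  have linL: "C - \<zeta> ^ i * x \<in> L" for i
    using CL \<zeta>L xyz_mem_L by (intro S3.E.diff_closed S3.E.mult_closed)
  have ge: "w (C - \<zeta> ^ i * x) \<ge> 0" for i
  proof -
    have "\<zeta> ^ i * x \<in> L" "\<zeta> ^ i * x \<noteq> 0" "w (\<zeta> ^ i * x) = 0"
      using \<zeta>L xyz_mem_L S1.theta_nonzero zeta_nonzero w\<zeta>i wx
      by (auto simp: val_mult S3.E.mult_closed)
    then show ?thesis
      using val_add[of C "- (\<zeta> ^ i * x)"] CL wC linear_nonzero[of i] val_uminus[of "\<zeta> ^ i * x"]
      by (simp add: S3.E.uminus_closed)
  qed
  have "(\<Sum>i<l. w (C - \<zeta> ^ i * x)) = w (\<Prod>i<l. C - \<zeta> ^ i * x)"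
    using linL linear_nonzero by (subst val_prod) auto
  also have "\<dots> = 0"
    using prod_minus_roots_of_unity[OF l_pos \<zeta>(2,3), of C x] w_xy(2) y by simp
  finally have "\<forall>i\<in>{..<l}. w (C - \<zeta> ^ i * x) = 0"
    using ge by (subst (asm) sum_nonneg_eq_0_iff) auto
  then have "w (eps x) = 0"
    unfolding eps_def using linL linear_nonzero
    by (subst val_prod) (auto simp: val_power S3.E.power_closed intro!: sum.neutral)
  then have wz: "w z = 0"
    using val_power[of z l] z_power xyz_mem_L z_nonzero l_pos by simp
  have sub: "S1.E \<subseteq> L" "S2.E \<subseteq> L" using S2.M_subset_E S3.M_subset_E by auto
  obtain b2 where b2: "b2 \<in> S2.E" "b2 \<noteq> 0" "w u = w b2"
    using value_group_kummer_step[OF S3.kummer_step_axioms _ wz wl w\<zeta> u] by blast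
  obtain b1 where b1: "b1 \<in> S1.E" "b1 \<noteq> 0" "w b2 = w b1"
    using value_group_kummer_step[OF S2.kummer_step_axioms sub(2) wy wl w\<zeta> b2(1,2)] by blast
  obtain b where "b \<in> K" "b \<noteq> 0" "w b1 = w b"
    using value_group_kummer_step[OF S1.kummer_step_axioms sub(1) wx wl w\<zeta> b1(1,2)] by blast
  then show ?thesis using b1 b2 by auto
qed

end


section \<open>Rational functions\<close>

lemma number_field_imp_field_subset: "number_field k \<Longrightarrow> field_subset k"
  by (simp add: number_field_def subfield_type_ring_iff)

lemma rat_funsE:
  assumes "u \<in> rat_funs k"
  obtains a b where "a \<in> polys k" "b \<in> polys k" "b \<noteq> 0" "u = to_fract a / to_fract b"
  using assms by (auto simp: rat_funs_def)

lemma rat_funsI: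
  "a \<in> polys k \<Longrightarrow> b \<in> polys k \<Longrightarrow> b \<noteq> 0 \<Longrightarrow> u = to_fract a / to_fract b \<Longrightarrow> u \<in> rat_funs k"
  by (auto simp: rat_funs_def)

lemma to_fract_mem_rat_funs:
  assumes "field_subset k" "p \<in> polys k"
  shows "to_fract p \<in> rat_funs k"
proof -
  interpret field_subset k by (rule assms)
  show ?thesis using assms(2) polys_closed by (intro rat_funsI[of p _ 1]) auto
qed

lemma field_subset_rat_funs:
  assumes "field_subset k"
  shows "field_subset (rat_funs k)"
proof -
  interpret k: field_subset k by (rule assms)
  note closed = k.polys_closed
  show ?thesis
  proof unfold_locales
    show "0 \<in> rat_funs k" "1 \<in> rat_funs k"
      using to_fract_mem_rat_funs[OF assms, of 0] to_fract_mem_rat_funs[OF assms, of 1] closed by auto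
    fix u assume "u \<in> rat_funs k"
    then obtain a b where ab: "a \<in> polys k" "b \<in> polys k" "b \<noteq> 0" "u = to_fract a / to_fract b"
      by (rule rat_funsE)
    show "- u \<in> rat_funs k"
      by (rule rat_funsI[of "- a" _ b]) (use ab in \<open>auto intro: closed\<close>)
    show "inverse u \<in> rat_funs k"
    proof (cases "a = 0")
      case True
      with ab \<open>0 \<in> rat_funs k\<close> show ?thesis by simp
    next
      case False
      with ab show ?thesis by (intro rat_funsI[of b _ a]) auto
    qed
    fix v assume "v \<in> rat_funs k"
    then obtain c d where cd: "c \<in> polys k" "d \<in> polys k" "d \<noteq> 0" "v = to_fract c / to_fract d"
      by (rule rat_funsE)
    show "u + v \<in> rat_funs k"
      by (rule rat_funsI[of "a * d + c * b" _ "b * d"])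
        (use ab cd in \<open>auto intro!: closed simp: add_frac_eq\<close>)
    show "u * v \<in> rat_funs k"
      by (rule rat_funsI[of "a * c" _ "b * d"]) (use ab cd in \<open>auto intro!: closed\<close>)
  qed
qed

lemma const_fun_simps:
  "const_fun 1 = 1" "const_fun (a * b) = const_fun a * const_fun b"
  "const_fun (a - b) = const_fun a - const_fun b"
  "const_fun (a ^ n) = const_fun a ^ n" "const_fun (of_nat n) = of_nat n"
proof -
  show "const_fun 1 = 1" by (simp add: const_fun_def flip: one_pCons)
  show mult: "const_fun (a * b) = const_fun a * const_fun b" for a b
    by (simp add: const_fun_def flip: to_fract_mult)
  show "const_fun (a - b) = const_fun a - const_fun b"
    by (simp add: const_fun_def flip: to_fract_diff)
  show "const_fun (a ^ n) = const_fun a ^ n"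
    by (induction n) (simp_all add: mult \<open>const_fun 1 = 1\<close>)
  show "const_fun (of_nat n) = of_nat n"
  proof (induction n)
    case (Suc n)
    have "const_fun (of_nat (Suc n)) = const_fun 1 + const_fun (of_nat n)"
      by (simp add: const_fun_def flip: to_fract_add)
    then show ?case by (simp add: Suc \<open>const_fun 1 = 1\<close>)
  qed (simp add: const_fun_def)
qed

lemma const_fun_eq_0_iff: "const_fun a = 0 \<longleftrightarrow> a = 0"
  by (simp add: const_fun_def)

lemma algebraic_closure_viaD:
  fixes \<iota> :: "complex poly fract \<Rightarrow> 'a::field"
  assumes "field_subset k" "algebraic_closure_via k \<iota>"
  shows "subset_hom (rat_funs k) \<iota>" "field_subset (\<iota> ` rat_funs k)"
    "(ring.algebraic type_ring over (\<iota> ` rat_funs k)) u"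
proof -
  interpret field_subset "rat_funs k" by (rule field_subset_rat_funs[OF assms(1)])
  have hom: "\<iota> \<in> ring_hom (rat_fun_field k) type_ring"
    and closure: "algebraic_closure type_ring (\<iota> ` rat_funs k)"
    using assms(2) by (auto simp: algebraic_closure_via_def)
  show "subset_hom (rat_funs k) \<iota>"
  proof unfold_locales
    show "\<iota> (a + b) = \<iota> a + \<iota> b" if "a \<in> rat_funs k" "b \<in> rat_funs k" for a b
      using ring_hom_add[OF hom, of a b] that by (simp add: rat_fun_field_def)
    show "\<iota> (a * b) = \<iota> a * \<iota> b" if "a \<in> rat_funs k" "b \<in> rat_funs k" for a b
      using ring_hom_mult[OF hom, of a b] that by (simp add: rat_fun_field_def)
    show "\<iota> 1 = 1"
      using ring_hom_one[OF hom] by (simp add: rat_fun_field_def)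
  qed
  then show "field_subset (\<iota> ` rat_funs k)" by (rule subset_hom.field_subset_image)
  show "(ring.algebraic type_ring over (\<iota> ` rat_funs k)) u"
    using algebraic_closure.algebraic_extension[OF closure, of u] by simp
qed

lemma order_power: "p \<noteq> 0 \<Longrightarrow> Polynomial.order a (p ^ n) = n * Polynomial.order a p"
  for p :: "'a::idom poly"
  by (induction n) (auto simp: order_mult)

lemma to_fract_power: "to_fract (p ^ n) = to_fract p ^ n"
  by (induction n) auto

text \<open>Orders of vanishing at \<open>a\<close>, after clearing the denominator of
  \<open>u\<close>, give 1 modulo \<open>l\<close> on the left and 0 on the right.\<close>

lemma order_1_not_power:
  assumes "l > 1" "u \<in> rat_funs k" "p \<noteq> 0" "Polynomial.order a p = 1" "Polynomial.order a q = 0"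
  shows "to_fract p \<noteq> u ^ l * to_fract q"
proof
  assume eq: "to_fract p = u ^ l * to_fract q"
  obtain f g where fg: "g \<noteq> 0" "u = to_fract f / to_fract g"
    using assms(2) by (rule rat_funsE)
  have "u * to_fract g = to_fract f" using fg by simp
  then have "u ^ l * to_fract (g ^ l) = to_fract (f ^ l)"
    by (simp add: to_fract_power flip: power_mult_distrib)
  then have "to_fract (p * g ^ l) = to_fract (f ^ l * q)"
    using eq by (simp add: ac_simps)
  then have eq': "p * g ^ l = f ^ l * q" by (simp only: to_fract_eq_iff)
  then have nz: "f ^ l * q \<noteq> 0" using assms(3) fg(1) by (metis mult_eq_0_iff power_not_zero)
  then have "f \<noteq> 0" using assms(1) by (auto simp: power_0_left)
  have "Polynomial.order a (p * g ^ l) = 1 + l * Polynomial.order a g"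
    using assms(3,4) fg(1) by (simp add: order_mult order_power)
  moreover have "Polynomial.order a (f ^ l * q) = l * Polynomial.order a f"
    using nz assms(5) \<open>f \<noteq> 0\<close> by (simp add: order_mult order_power)
  ultimately have "1 + l * Polynomial.order a g = l * Polynomial.order a f"
    using eq' by simp
  then have "l dvd 1" by (metis dvd_add_left_iff dvd_triv_left)
  then show False using assms(1) by simp
qed

lemma monic_dvd_linear:
  fixes p :: "'a::field poly"
  assumes "Polynomial.degree p > 0" "Polynomial.lead_coeff p = 1" "p dvd [:- a, 1:]"
  shows "p = [:- a, 1:]"
proof -
  obtain q where q: "[:- a, 1:] = p * q" using assms(3) by (elim dvdE)
  then have nz: "p \<noteq> 0" "q \<noteq> 0" by (metis mult_zero_left mult_zero_right one_neq_zero pCons_eq_0_iff)+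
  have "Polynomial.degree (p * q) = 1" unfolding q[symmetric] by simp
  then have "Polynomial.degree q = 0" using nz assms(1) by (simp add: degree_mult_eq)
  then obtain b where b: "q = [:b:]" by (meson degree_eq_zeroE)
  have "Polynomial.lead_coeff p * Polynomial.lead_coeff q = 1"
    unfolding lead_coeff_mult[symmetric] q[symmetric] by simp
  then have "b = 1" using assms(2) b by simp
  then show ?thesis using q b by simp
qed

lemma root_of_unity:
  assumes "l > 0" "\<zeta> = exp (2 * complex_of_real pi * \<i> / of_nat l)"
  shows "\<zeta> ^ l = 1" "\<And>i. 0 < i \<Longrightarrow> i < l \<Longrightarrow> \<zeta> ^ i \<noteq> 1"
proof -
  have \<zeta>: "\<zeta> ^ i = cis (2 * pi * real i / real l)" for i
    unfolding assms(2) by (simp add: cis_conv_exp flip: exp_of_nat_mult) (simp add: algebra_simps)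
  show "\<zeta> ^ l = 1" using assms(1) by (simp add: \<zeta>)
  fix i assume i: "0 < i" "i < l"
  have "inj_on (\<lambda>k. cis (2 * pi * real k / real l)) {..<l}"
    using bij_betw_roots_unity[OF assms(1)] by (simp add: bij_betw_def)
  from inj_onD[OF this, of i 0] show "\<zeta> ^ i \<noteq> 1" using i by (auto simp: \<zeta>)
qed

text \<open>\<iota> is injective on \<open>k(t)\<close>, so the equations to be excluded can be
  pulled back to rational functions. That \<open>c\<close> is nonzero separates the points 0 and
  \<open>c^l\<close>: the power of \<open>t\<close> allowed in \<open>not_power\<close> does not
  vanish at \<open>c^l\<close>, where \<open>c^l - t\<close> has a simple zero.\<close>

lemma heisenberg_tower_rat_funs:
  fixes \<iota> :: "complex poly fract \<Rightarrow> 'a::field"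
  assumes l: "prime l"
    and k: "field_subset k"
    and \<zeta>: "\<zeta> ^ l = 1" "\<And>i. 0 < i \<Longrightarrow> i < l \<Longrightarrow> \<zeta> ^ i \<noteq> 1" "\<zeta> \<in> k"
    and c: "c \<in> k" "c \<noteq> 0"
    and \<iota>: "algebraic_closure_via k \<iota>"
    and x: "x ^ l = \<iota> indet"
    and y: "y ^ l = \<iota> (const_fun (c ^ l) - indet)"
    and z: "z ^ l = (\<Prod>i = 1..l - 1. (\<iota> (const_fun c) - \<iota> (const_fun (\<zeta> ^ i)) * x) ^ i)"
  shows "heisenberg_tower (\<iota> ` rat_funs k) l (\<iota> (const_fun \<zeta>)) (\<iota> (const_fun c)) x y z"
proof -
  interpret k: field_subset k by (rule k)
  interpret \<iota>: subset_hom "rat_funs k" \<iota> by (rule algebraic_closure_viaD(1)[OF k \<iota>])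
  interpret K: field_subset "\<iota> ` rat_funs k" by (rule algebraic_closure_viaD(2)[OF k \<iota>])
  have l1: "l > 1" using l by (rule prime_gt_1_nat)
  have const: "const_fun a \<in> rat_funs k" if "a \<in> k" for a
    unfolding const_fun_def using that by (intro to_fract_mem_rat_funs[OF k] k.const_polys)
  have indet: "indet \<in> rat_funs k"
    unfolding indet_def
    by (intro to_fract_mem_rat_funs[OF k] k.pCons_polys k.const_polys k.closed)
  have inj: "u = v" if "\<iota> u = \<iota> v" "u \<in> rat_funs k" "v \<in> rat_funs k" for u v
    using that inj_onD[OF \<iota>.hom_inj] by blast
  have \<zeta>pow: "\<iota> (const_fun \<zeta>) ^ i = \<iota> (const_fun (\<zeta> ^ i))" for i
    using const[OF \<zeta>(3)] by (simp add: const_fun_simps \<iota>.hom_power)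
  show ?thesis
  proof unfold_locales
    show "prime l" by (rule l)
    show "\<iota> (const_fun \<zeta>) \<in> \<iota> ` rat_funs k" "\<iota> (const_fun c) \<in> \<iota> ` rat_funs k"
      using const \<zeta>(3) c by auto
    show "\<iota> (const_fun \<zeta>) ^ l = 1"
      by (simp add: \<zeta>pow \<zeta>(1) const_fun_simps(1) \<iota>.hom_one)
    show "\<iota> (const_fun \<zeta>) ^ i \<noteq> 1" if "0 < i" "i < l" for i
    proof
      assume "\<iota> (const_fun \<zeta>) ^ i = 1"
      then have "const_fun (\<zeta> ^ i) = const_fun 1"
        using inj[of "const_fun (\<zeta> ^ i)" 1] const[of "\<zeta> ^ i"] \<zeta>(3)
        by (simp add: \<zeta>pow \<iota>.hom_one k.power_closed \<iota>.one_closed const_fun_simps(1))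
      then show False using \<zeta>(2)[OF that] by (simp add: const_fun_def)
    qed
    show "x ^ l \<in> \<iota> ` rat_funs k" using x indet by simp
    show "x \<notin> \<iota> ` rat_funs k"
    proof
      assume "x \<in> \<iota> ` rat_funs k"
      then obtain u where u: "u \<in> rat_funs k" "x = \<iota> u" by blast
      then have "indet = u ^ l"
        using x indet by (intro inj) (auto simp: \<iota>.hom_power \<iota>.power_closed)
      moreover have "Polynomial.order 0 [:0, 1::complex:] = 1"
        using order_power_n_n[of "0::complex" 1] by simp
      ultimately show False
        using order_1_not_power[OF l1 u(1), of "[:0, 1:]" 0 1] by (simp add: indet_def)
    qed
    show "y ^ l = \<iota> (const_fun c) ^ l - x ^ l"
      using const[of c] const[of "c ^ l"] c indet
      by (simp add: x y \<iota>.hom_diff const_fun_simps \<iota>.hom_power \<iota>.power_closed)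
    show "z ^ l = (\<Prod>i = 1..l - 1. (\<iota> (const_fun c) - \<iota> (const_fun \<zeta>) ^ i * x) ^ i)"
      by (simp add: z \<zeta>pow)
    show "(ring.algebraic type_ring over \<iota> ` rat_funs k) u" for u
      by (rule algebraic_closure_viaD(3)[OF k \<iota>])
    show "y ^ l \<noteq> b ^ l * (x ^ l) ^ j" if b: "b \<in> \<iota> ` rat_funs k" for b j
    proof
      assume eq: "y ^ l = b ^ l * (x ^ l) ^ j"
      obtain u where u: "u \<in> rat_funs k" "b = \<iota> u" using b by blast
      have "c ^ l \<in> k" using c by (intro k.power_closed)
      then have "const_fun (c ^ l) - indet = u ^ l * indet ^ j"
        using eq u indet const[of "c ^ l"] x y
        by (intro inj) (auto simp: \<iota>.hom_power \<iota>.hom_mult \<iota>.power_closed \<iota>.mult_closed \<iota>.diff_closed)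
      also have "indet ^ j = to_fract ([:0, 1:] ^ j)"
        by (simp add: indet_def to_fract_power)
      also have "const_fun (c ^ l) - indet = to_fract (- [:- (c ^ l), 1:])"
        by (simp add: const_fun_def indet_def flip: to_fract_diff)
      finally have "to_fract (- [:- (c ^ l), 1:]) = u ^ l * to_fract ([:0, 1:] ^ j)" .
      moreover have "Polynomial.order (c ^ l) (- [:- (c ^ l), 1:]) = 1"
        using order_power_n_n[of "c ^ l" 1] by (simp del: minus_pCons)
      moreover have "Polynomial.order (c ^ l) ([:0, 1:] ^ j) = 0"
        using c by (intro order_0I) simp
      ultimately show False
        using order_1_not_power[OF l1 u(1), of "- [:- (c ^ l), 1:]" "c ^ l" "[:0, 1:] ^ j"]
        by (simp del: to_fract_uminus)
    qed
  qed
qed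

theorem theorem2p1p4:
  fixes l :: nat
    and k :: "complex set"
    and c \<zeta> :: complex
    and \<iota> :: "complex poly fract \<Rightarrow> 'a::field"
    and x y z :: 'a
    and R :: "'a set"
  assumes "prime l"
    and "number_field k"
    and "\<zeta> = exp (2 * complex_of_real pi * \<i> / of_nat l)"
    and "\<zeta> \<in> k"
    and "c \<in> k" and "c \<noteq> 0"
    and "algebraic_closure_via k \<iota>"
    and "x ^ l = \<iota> indet"
    and "y ^ l = \<iota> (const_fun (c ^ l) - indet)"
    and "z ^ l = (\<Prod>i = 1..l - 1. (\<iota> (const_fun c) - \<iota> (const_fun (\<zeta> ^ i)) * x) ^ i)"
    and "R = generate_field ring_of_type_algebra (\<iota> ` rat_funs k \<union> {x, y, z})"
  shows "galois_extension (\<iota> ` rat_funs k) R \<and>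
         galois_group (\<iota> ` rat_funs k) R \<cong> heisenberg_group (residue_ring (int l)) \<and>
         unramified_outside k \<iota> R {At_infinity, rational_point 0, rational_point (c ^ l)}"
proof -
  have k: "field_subset k" by (rule number_field_imp_field_subset[OF assms(2)])
  have l0: "l > 0" using assms(1) by (rule prime_gt_0_nat)
  interpret k: field_subset k by (rule k)
  interpret \<iota>: subset_hom "rat_funs k" \<iota> by (rule algebraic_closure_viaD(1)[OF k assms(7)])
  note unity = root_of_unity[OF l0 assms(3)]
  interpret heisenberg_tower "\<iota> ` rat_funs k" l "\<iota> (const_fun \<zeta>)" "\<iota> (const_fun c)" x y z
    by (rule heisenberg_tower_rat_funs[OF assms(1) k unity assms(4-10)])
  have R: "R = L" using L_eq_generate_field assms(11) by simp
  have const: "const_fun a \<in> rat_funs k" if "a \<in> k" for a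
    unfolding const_fun_def using that by (intro to_fract_mem_rat_funs[OF k] k.const_polys)
  have "unramified_outside k \<iota> L {At_infinity, rational_point 0, rational_point (c ^ l)}"
    unfolding unramified_outside_def unramified_at_def
  proof (intro ballI allI impI; elim conjE)
    fix P w e
    assume P: "P \<in> closed_points k - {At_infinity, rational_point 0, rational_point (c ^ l)}"
      and w: "discrete_valuation_on L w" and above: "lies_above k \<iota> w P e"
    interpret valuation_on L w
      by unfold_locales (use w in \<open>auto simp: discrete_valuation_on_def\<close>)
    obtain p where p: "P = Affine p" "irreducible_over k p" "Polynomial.lead_coeff p = 1"
      "p \<noteq> [:0, 1:]" "p \<noteq> [:- (c ^ l), 1:]"
      using P by (auto simp: closed_points_def rational_point_def)
    \<comment> \<open>A monic constant is 1, a unit, hence not irreducible. Positive degree makes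
      nonzero constants prime to \<open>p\<close>, so they have value 0.\<close>
    have degp: "Polynomial.degree p > 0"
    proof (rule ccontr)
      assume "\<not> Polynomial.degree p > 0"
      then have "p = 1" using p(3) by (metis degree_eq_zeroE gr0I lead_coeff_pCons(2) one_pCons)
      moreover have "1 \<in> Units (polys_over k)"
        using k.polys_closed by (auto simp: Units_def polys_over_simps)
      ultimately show False
        using p(2) by (simp add: ring_irreducible_def Divisibility.irreducible_def)
    qed
    have w_rat: "w (\<iota> (to_fract a / to_fract b)) = int e * (ord_at P a - ord_at P b)"
      if "a \<in> polys k" "b \<in> polys k" "a \<noteq> 0" "b \<noteq> 0" for a b
      using above that by (simp add: lies_above_def)
    have w_poly: "w (\<iota> (to_fract a)) = 0" if "a \<in> polys k" "a \<noteq> 0" "\<not> p dvd a" for a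
      using w_rat[of a 1] that k.polys_closed by (simp add: p(1) not_dvd_imp_multiplicity_0)
    have w_const: "w (\<iota> (const_fun a)) = 0" if "a \<in> k" "a \<noteq> 0" for a
      unfolding const_fun_def using that degp dvd_imp_degree_le[of p "[:a:]"]
      by (intro w_poly k.const_polys) auto
    \<comment> \<open>At a point other than the three exceptional ones, \<open>t\<close>,
      \<open>c^l - t\<close> and all nonzero constants have value 0, which is what
      \<open>value_group\<close> requires.\<close>
    have ex_val: "\<exists>b\<in>\<iota> ` rat_funs k. b \<noteq> 0 \<and> w u = w b" if u: "u \<in> L" "u \<noteq> 0" for u
    proof (rule value_group[OF valuation_on_axioms _ _ _ _ _ _ _ u])
      have of_nat: "of_nat l = \<iota> (const_fun (of_nat l))"
      proof -
        have "\<iota> (of_nat n) = of_nat n" for n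
          by (induction n) (auto simp: \<iota>.hom_zero \<iota>.hom_add \<iota>.hom_one \<iota>.closed)
        then show ?thesis by (simp add: const_fun_simps)
      qed
      show "(of_nat l :: 'a) \<noteq> 0"
        unfolding of_nat using const[OF k.of_nat_closed, of l] l0
        by (simp add: \<iota>.hom_eq_0_iff const_fun_eq_0_iff)
      show "w (of_nat l) = 0"
        unfolding of_nat using l0 by (intro w_const k.of_nat_closed) simp
      show "w (\<iota> (const_fun \<zeta>) ^ i - 1) = 0" if "0 < i" "i < l" for i
      proof -
        have "\<iota> (const_fun \<zeta>) ^ i - 1 = \<iota> (const_fun (\<zeta> ^ i - 1))"
          using const[OF assms(4)]
          by (simp add: const_fun_simps \<iota>.hom_diff \<iota>.hom_power \<iota>.hom_one \<iota>.closed)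
        moreover have "\<zeta> ^ i - 1 \<in> k" using assms(4) by (intro k.diff_closed k.power_closed k.one_closed)
        ultimately show ?thesis using w_const unity(2)[OF that] by simp
      qed
      show "\<iota> (const_fun c) \<noteq> 0"
        using const[OF assms(5)] assms(6) by (simp add: \<iota>.hom_eq_0_iff const_fun_eq_0_iff)
      show "w (\<iota> (const_fun c)) = 0" using assms(5,6) by (rule w_const)
      show "w (x ^ l) = 0"
        unfolding assms(8) indet_def
      proof (rule w_poly)
        \<comment> \<open>A monic nonconstant divisor of \<open>t\<close> is \<open>t\<close>
          itself, and that point is excluded.\<close>
        show "\<not> p dvd [:0, 1:]" using monic_dvd_linear[OF degp p(3), of 0] p(4) by auto
        show "[:0, 1:] \<in> polys k" by (intro k.pCons_polys k.const_polys k.closed)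
      qed simp
      have "c ^ l \<in> k" using assms(5) by (rule k.power_closed)
      have "const_fun (c ^ l) - indet = to_fract (- [:- (c ^ l), 1:])"
        by (simp add: const_fun_def indet_def flip: to_fract_diff)
      moreover have "w (\<iota> (to_fract (- [:- (c ^ l), 1:]))) = 0"
      proof (rule w_poly)
        show "\<not> p dvd - [:- (c ^ l), 1:]"
          using monic_dvd_linear[OF degp p(3), of "c ^ l"] p(5) by (auto simp del: minus_pCons)
        show "- [:- (c ^ l), 1:] \<in> polys k"
          using \<open>c ^ l \<in> k\<close> by (intro k.polys_closed k.linear_polys)
      qed simp
      ultimately show "w (y ^ l) = 0" unfolding assms(9) by simp
    qed
    \<comment> \<open>Every value on \<open>L\<close> is a value on \<open>k(t)\<close>, hence a
      multiple of \<open>e\<close>. As \<open>w\<close> is normalised it takes the value 1, which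
      forces \<open>e = 1\<close>.\<close>
    have dvd: "int e dvd w u" if u: "u \<in> L" "u \<noteq> 0" for u
    proof -
      obtain v where v: "v \<in> rat_funs k" "\<iota> v \<noteq> 0" "w u = w (\<iota> v)"
        using ex_val[OF u] by blast
      obtain a b where ab: "a \<in> polys k" "b \<in> polys k" "b \<noteq> 0" "v = to_fract a / to_fract b"
        using v(1) by (rule rat_funsE)
      have "a \<noteq> 0" using v(2) ab \<iota>.hom_zero by auto
      then show ?thesis using w_rat[of a b] ab v(3) by simp
    qed
    have "1 \<in> w ` (L - {0})" using w by (simp add: discrete_valuation_on_def)
    then obtain u where "1 = w u" "u \<in> L - {0}" by (rule imageE)
    with dvd[of u] show "e = 1" by simp
  qed
  then show ?thesis
    using galois_extension_L galois_group_iso_heisenberg by (simp add: R)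
qed

end
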